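(* Let $g$ be a light-line-complete connected pseudo-Riemannian metric of indefinite signature on a closed $n$-dimensional manifold $M^n$ (that is, $M^n$ is connected and $g$ is a light-line-complete pseudo-Riemannian metric of indefinite signature on it). Then every function $\lambda$ on $M^n$ that satisfies $$\nabla_k \nabla_j \nabla_i \lambda + 2\, \nabla_k \lambda \cdot g_{ij} + \nabla_i \lambda \cdot g_{jk} + \nabla_j \lambda \cdot g_{ik}=0 \qquad (i,j,k\in\{1,\dots,n\})$$ is constant.
   Context: All objects are smooth. $\nabla$ denotes the Levi-Civita covariant derivative of $g$ and indices refer to local coordinates on $M^n$. A closed manifold is a compact manifold without boundary. The metric $g$ has indefinite signature if for no constant $c$ the metric $c\cdot g$ is Riemannian. A light-line geodesic is an affinely parametrized geodesic $\gamma$ with $g(\dot\gamma,\dot\gamma)=0$; $g$ is light-line-complete if every light-line geodesic can be extended to be defined on all of $\mathbb{R}$. *)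

theory Defs
  imports "HOL-Analysis.Analysis"
begin

section \<open>Smooth maps between vector spaces\<close>

text \<open>\<open>C_k_on k S f\<close> is only meant for open \<open>S\<close>. The last conjunct speaks about all
  directional derivatives, i.e. in finite dimension about all partial derivatives.\<close>

fun C_k_on :: "nat \<Rightarrow> 'a::real_normed_vector set \<Rightarrow> ('a \<Rightarrow> 'b::real_normed_vector) \<Rightarrow> bool" where
  "C_k_on 0 S f \<longleftrightarrow> continuous_on S f"
| "C_k_on (Suc k) S f \<longleftrightarrow>
     (\<forall>x\<in>S. f differentiable (at x)) \<and> (\<forall>v. C_k_on k S (\<lambda>x. frechet_derivative f (at x) v))"

definition smooth_on :: "'a::real_normed_vector set \<Rightarrow> ('a \<Rightarrow> 'b::real_normed_vector) \<Rightarrow> bool" where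
  "smooth_on S f \<longleftrightarrow> (\<forall>k. C_k_on k S f)"

definition pderiv_at :: "'n::finite \<Rightarrow> (real^'n \<Rightarrow> real) \<Rightarrow> real^'n \<Rightarrow> real" where
  "pderiv_at i f x = frechet_derivative f (at x) (axis i 1)"


section \<open>Smooth manifolds\<close>

text \<open>A chart is a pair of a domain and a coordinate map; the values of the coordinate map
  outside the domain are irrelevant. The dimension of the manifold is \<open>CARD('n)\<close>.\<close>

type_synonym ('a, 'n) chart = "'a set \<times> ('a \<Rightarrow> real^'n)"

abbreviation dom_chart :: "('a, 'n::finite) chart \<Rightarrow> 'a set" where
  "dom_chart c \<equiv> fst c"

abbreviation coord :: "('a, 'n::finite) chart \<Rightarrow> 'a \<Rightarrow> real^'n" where
  "coord c \<equiv> snd c"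

definition img_chart :: "('a, 'n::finite) chart \<Rightarrow> (real^'n) set" where
  "img_chart c = coord c ` dom_chart c"

definition inv_chart :: "('a, 'n::finite) chart \<Rightarrow> real^'n \<Rightarrow> 'a" where
  "inv_chart c = inv_into (dom_chart c) (coord c)"

definition is_chart :: "'a topology \<Rightarrow> ('a, 'n::finite) chart \<Rightarrow> bool" where
  "is_chart X c \<longleftrightarrow> openin X (dom_chart c) \<and> open (img_chart c) \<and>
     homeomorphic_map (subtopology X (dom_chart c)) (top_of_set (img_chart c)) (coord c)"

definition overlap :: "('a, 'n::finite) chart \<Rightarrow> ('a, 'n) chart \<Rightarrow> (real^'n) set" where
  "overlap c d = coord c ` (dom_chart c \<inter> dom_chart d)"

definition transition :: "('a, 'n::finite) chart \<Rightarrow> ('a, 'n) chart \<Rightarrow> real^'n \<Rightarrow> real^'n" where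
  "transition c d = coord d \<circ> inv_chart c"

text \<open>The atlas \<open>A\<close> is not required to be maximal.\<close>

definition smooth_manifold :: "'a topology \<Rightarrow> ('a, 'n::finite) chart set \<Rightarrow> bool" where
  "smooth_manifold X A \<longleftrightarrow>
     Hausdorff_space X \<and> second_countable X \<and>
     (\<forall>c\<in>A. is_chart X c) \<and> topspace X = (\<Union>c\<in>A. dom_chart c) \<and>
     (\<forall>c\<in>A. \<forall>d\<in>A. smooth_on (overlap c d) (transition c d))"

definition closed_manifold :: "'a topology \<Rightarrow> ('a, 'n::finite) chart set \<Rightarrow> bool" where
  "closed_manifold X A \<longleftrightarrow> smooth_manifold X A \<and> compact_space X"

definition in_chart :: "('a \<Rightarrow> real) \<Rightarrow> ('a, 'n::finite) chart \<Rightarrow> real^'n \<Rightarrow> real" where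
  "in_chart f c = f \<circ> inv_chart c"

definition smooth_function :: "('a, 'n::finite) chart set \<Rightarrow> ('a \<Rightarrow> real) \<Rightarrow> bool" where
  "smooth_function A f \<longleftrightarrow> (\<forall>c\<in>A. smooth_on (img_chart c) (in_chart f c))"


section \<open>Pseudo-Riemannian metrics\<close>

text \<open>A field of bilinear forms on the tangent spaces is given by its component matrices
  \<open>g c x $ i $ j\<close> in every chart \<open>c\<close> of the atlas at every \<open>x \<in> img_chart c\<close>, subject to the
  transformation law of covariant 2-tensors.\<close>

type_synonym ('a, 'n) tensor2 = "('a, 'n) chart \<Rightarrow> real^'n \<Rightarrow> real^'n^'n"

definition smooth_tensor2 :: "('a, 'n::finite) chart set \<Rightarrow> ('a, 'n) tensor2 \<Rightarrow> bool" where
  "smooth_tensor2 A g \<longleftrightarrow>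
     (\<forall>c\<in>A. smooth_on (img_chart c) (g c)) \<and>
     (\<forall>c\<in>A. \<forall>d\<in>A. \<forall>x\<in>overlap c d.
        let J = jacobian (transition c d) (at x)
        in g c x = transpose J ** g d (transition c d x) ** J)"

definition pseudo_riemannian_metric ::
    "('a, 'n::finite) chart set \<Rightarrow> ('a, 'n) tensor2 \<Rightarrow> bool" where
  "pseudo_riemannian_metric A g \<longleftrightarrow>
     smooth_tensor2 A g \<and>
     (\<forall>c\<in>A. \<forall>x\<in>img_chart c. transpose (g c x) = g c x \<and> invertible (g c x))"

definition riemannian_metric ::
    "('a, 'n::finite) chart set \<Rightarrow> ('a, 'n) tensor2 \<Rightarrow> bool" where
  "riemannian_metric A g \<longleftrightarrow>
     pseudo_riemannian_metric A g \<and>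
     (\<forall>c\<in>A. \<forall>x\<in>img_chart c. \<forall>v. v \<noteq> 0 \<longrightarrow> v \<bullet> (g c x *v v) > 0)"

definition indefinite_signature ::
    "('a, 'n::finite) chart set \<Rightarrow> ('a, 'n) tensor2 \<Rightarrow> bool" where
  "indefinite_signature A g \<longleftrightarrow> \<not> (\<exists>k::real. riemannian_metric A (\<lambda>c x. k *\<^sub>R g c x))"


section \<open>The Levi-Civita connection\<close>

text \<open>In this section \<open>G\<close> is the component matrix of the metric in a fixed chart;
  \<open>christoffel G k i j\<close> is $\Gamma^k_{ij}$.\<close>

definition christoffel ::
    "(real^'n \<Rightarrow> real^'n^'n) \<Rightarrow> 'n::finite \<Rightarrow> 'n \<Rightarrow> 'n \<Rightarrow> real^'n \<Rightarrow> real" where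
  "christoffel G k i j x = (1/2) * (\<Sum>l\<in>UNIV. matrix_inv (G x) $ k $ l *
     (pderiv_at i (\<lambda>y. G y $ j $ l) x + pderiv_at j (\<lambda>y. G y $ i $ l) x
       - pderiv_at l (\<lambda>y. G y $ i $ j) x))"

definition differential :: "(real^'n \<Rightarrow> real) \<Rightarrow> 'n::finite \<Rightarrow> real^'n \<Rightarrow> real" where
  "differential f i x = pderiv_at i f x"

text \<open>\<open>nabla1 G w j i\<close> is $\nabla_j w_i$ and \<open>nabla2 G T k j i\<close> is $\nabla_k T_{ji}$.\<close>

definition nabla1 :: "(real^'n \<Rightarrow> real^'n^'n) \<Rightarrow> ('n \<Rightarrow> real^'n \<Rightarrow> real) \<Rightarrow>
    'n::finite \<Rightarrow> 'n \<Rightarrow> real^'n \<Rightarrow> real" where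
  "nabla1 G w j i x = pderiv_at j (w i) x - (\<Sum>l\<in>UNIV. christoffel G l j i x * w l x)"

definition nabla2 :: "(real^'n \<Rightarrow> real^'n^'n) \<Rightarrow> ('n \<Rightarrow> 'n \<Rightarrow> real^'n \<Rightarrow> real) \<Rightarrow>
    'n::finite \<Rightarrow> 'n \<Rightarrow> 'n \<Rightarrow> real^'n \<Rightarrow> real" where
  "nabla2 G T k j i x = pderiv_at k (T j i) x
     - (\<Sum>l\<in>UNIV. christoffel G l k j x * T l i x)
     - (\<Sum>l\<in>UNIV. christoffel G l k i x * T j l x)"

text \<open>The connection given by \<open>christoffel\<close> is the Levi-Civita connection: it is torsion-free
  and metric.\<close>

lemma pderiv_at_cong:
  assumes "open S" "x \<in> S" "\<And>y. y \<in> S \<Longrightarrow> f y = h y"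
  shows "pderiv_at i f x = pderiv_at i h x"
proof -
  have "(f has_derivative f') (at x) \<longleftrightarrow> (h has_derivative f') (at x)" for f'
    using assms has_derivative_transform_within_open[of f f' x UNIV S h]
      has_derivative_transform_within_open[of h f' x UNIV S f] by auto
  then show ?thesis
    by (simp add: pderiv_at_def frechet_derivative_def)
qed

lemma pderiv_at_metric_sym:
  fixes G :: "real^'n::finite \<Rightarrow> real^'n^'n"
  assumes "open S" "x \<in> S" and sym: "\<And>y. y \<in> S \<Longrightarrow> transpose (G y) = G y"
  shows "pderiv_at k (\<lambda>y. G y $ i $ j) x = pderiv_at k (\<lambda>y. G y $ j $ i) x"
proof (rule pderiv_at_cong[OF assms(1,2)])
  fix y assume "y \<in> S"
  then have "transpose (G y) $ i $ j = G y $ i $ j" using sym by simp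
  then show "G y $ i $ j = G y $ j $ i" by (simp add: transpose_def)
qed

lemma christoffel_sym:
  fixes G :: "real^'n::finite \<Rightarrow> real^'n^'n"
  assumes "open S" "x \<in> S" and "\<And>y. y \<in> S \<Longrightarrow> transpose (G y) = G y"
  shows "christoffel G k i j x = christoffel G k j i x"
proof -
  have "pderiv_at l (\<lambda>y. G y $ i $ j) x = pderiv_at l (\<lambda>y. G y $ j $ i) x" for l
    using assms by (rule pderiv_at_metric_sym)
  then show ?thesis
    by (simp add: christoffel_def add.commute)
qed

lemma christoffel_lower:
  fixes G :: "real^'n::finite \<Rightarrow> real^'n^'n"
  assumes "invertible (G x)"
  shows "(\<Sum>k\<in>UNIV. G x $ m $ k * christoffel G k i j x) =
    (1/2) * (pderiv_at i (\<lambda>y. G y $ j $ m) x + pderiv_at j (\<lambda>y. G y $ i $ m) x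
       - pderiv_at m (\<lambda>y. G y $ i $ j) x)"
proof -
  define b where "b l = pderiv_at i (\<lambda>y. G y $ j $ l) x + pderiv_at j (\<lambda>y. G y $ i $ l) x
       - pderiv_at l (\<lambda>y. G y $ i $ j) x" for l
  have "G x ** matrix_inv (G x) = mat 1"
    using assms unfolding invertible_def matrix_inv_def by (rule someI2_ex) simp
  then have id: "(\<Sum>k\<in>UNIV. G x $ m $ k * matrix_inv (G x) $ k $ l) = (if m = l then 1 else 0)" for l
    by (simp add: matrix_matrix_mult_def mat_def vec_eq_iff)
  have "(\<Sum>k\<in>UNIV. G x $ m $ k * christoffel G k i j x) =
      (\<Sum>k\<in>UNIV. \<Sum>l\<in>UNIV. (1/2) * (G x $ m $ k * matrix_inv (G x) $ k $ l * b l))"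
    unfolding christoffel_def b_def by (simp add: sum_distrib_left mult_ac)
  also have "\<dots> = (\<Sum>l\<in>UNIV. \<Sum>k\<in>UNIV. (1/2) * (G x $ m $ k * matrix_inv (G x) $ k $ l * b l))"
    by (rule sum.swap)
  also have "\<dots> = (\<Sum>l\<in>UNIV. (1/2) * ((\<Sum>k\<in>UNIV. G x $ m $ k * matrix_inv (G x) $ k $ l) * b l))"
    by (simp add: sum_distrib_left sum_distrib_right)
  also have "\<dots> = (\<Sum>l\<in>UNIV. if m = l then (1/2) * b l else 0)"
    unfolding id by (intro sum.cong) auto
  also have "\<dots> = (1/2) * b m" by simp
  finally show ?thesis by (simp add: b_def)
qed

lemma nabla_metric:
  fixes G :: "real^'n::finite \<Rightarrow> real^'n^'n"
  assumes "open S" "x \<in> S" and sym: "\<And>y. y \<in> S \<Longrightarrow> transpose (G y) = G y"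
    and inv: "invertible (G x)"
  shows "nabla2 G (\<lambda>i j y. G y $ i $ j) k i j x = 0"
proof -
  have psym: "pderiv_at l (\<lambda>y. G y $ p $ q) x = pderiv_at l (\<lambda>y. G y $ q $ p) x" for l p q
    using assms(1-3) by (rule pderiv_at_metric_sym)
  have "transpose (G x) $ j $ l = G x $ j $ l" for l using assms by simp
  then have "G x $ l $ j = G x $ j $ l" for l by (simp add: transpose_def)
  then have "(\<Sum>l\<in>UNIV. christoffel G l k i x * G x $ l $ j) =
      (\<Sum>l\<in>UNIV. G x $ j $ l * christoffel G l k i x)"
    by (simp add: mult.commute)
  moreover have "(\<Sum>l\<in>UNIV. christoffel G l k j x * G x $ i $ l) =
      (\<Sum>l\<in>UNIV. G x $ i $ l * christoffel G l k j x)"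
    by (simp add: mult.commute)
  ultimately show ?thesis
    using psym[of k i j] psym[of i k j] psym[of j k i]
    unfolding nabla2_def christoffel_lower[of G x, OF inv] by (simp add: field_simps)
qed


section \<open>Geodesics\<close>

definition local_curve :: "('a, 'n::finite) chart \<Rightarrow> (real \<Rightarrow> 'a) \<Rightarrow> real \<Rightarrow> real^'n" where
  "local_curve c \<gamma> = coord c \<circ> \<gamma>"

definition velocity :: "(real \<Rightarrow> real^'n) \<Rightarrow> real \<Rightarrow> real^'n::finite" where
  "velocity u t = vector_derivative u (at t)"

text \<open>The domain \<open>I\<close> of a geodesic is meant to be an open interval.\<close>

definition geodesic_on :: "'a topology \<Rightarrow> ('a, 'n::finite) chart set \<Rightarrow> ('a, 'n) tensor2 \<Rightarrow>
    real set \<Rightarrow> (real \<Rightarrow> 'a) \<Rightarrow> bool" where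
  "geodesic_on X A g I \<gamma> \<longleftrightarrow>
     continuous_map (top_of_set I) X \<gamma> \<and>
     (\<forall>c\<in>A. let u = local_curve c \<gamma>; J = {t\<in>I. \<gamma> t \<in> dom_chart c} in
        smooth_on J u \<and>
        (\<forall>t\<in>J. \<forall>k. velocity (velocity u) t $ k +
           (\<Sum>i\<in>UNIV. \<Sum>j\<in>UNIV. christoffel (g c) k i j (u t) *
              velocity u t $ i * velocity u t $ j) = 0))"

definition light_line_geodesic_on :: "'a topology \<Rightarrow> ('a, 'n::finite) chart set \<Rightarrow>
    ('a, 'n) tensor2 \<Rightarrow> real set \<Rightarrow> (real \<Rightarrow> 'a) \<Rightarrow> bool" where
  "light_line_geodesic_on X A g I \<gamma> \<longleftrightarrow>
     geodesic_on X A g I \<gamma> \<and>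
     (\<forall>c\<in>A. \<forall>t\<in>I. \<gamma> t \<in> dom_chart c \<longrightarrow>
        (let u = local_curve c \<gamma> in velocity u t \<bullet> (g c (u t) *v velocity u t) = 0))"

definition light_line_complete :: "'a topology \<Rightarrow> ('a, 'n::finite) chart set \<Rightarrow>
    ('a, 'n) tensor2 \<Rightarrow> bool" where
  "light_line_complete X A g \<longleftrightarrow>
     (\<forall>I \<gamma>. open I \<and> is_interval I \<and> I \<noteq> {} \<and> light_line_geodesic_on X A g I \<gamma> \<longrightarrow>
        (\<exists>\<gamma>'. light_line_geodesic_on X A g UNIV \<gamma>' \<and> (\<forall>t\<in>I. \<gamma>' t = \<gamma> t)))"


section \<open>The equation\<close>

definition tanno_equation :: "('a, 'n::finite) chart set \<Rightarrow> ('a, 'n) tensor2 \<Rightarrow> ('a \<Rightarrow> real) \<Rightarrow> bool"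
  where
  "tanno_equation A g lam \<longleftrightarrow>
     (\<forall>c\<in>A. \<forall>x\<in>img_chart c. \<forall>i j k.
        let G = g c; L = in_chart lam c; dL = differential L in
          nabla2 G (nabla1 G dL) k j i x
            + 2 * dL k x * G x $ i $ j + dL i x * G x $ j $ k + dL j x * G x $ i $ k = 0)"

end

theory Submission
  imports Defs
begin

text \<open>
  The light-like directions carry the whole argument. Let \<open>\<gamma>\<close> be a geodesic whose velocity \<open>v\<close> is a
  null vector. Contracting the equation three times with \<open>v\<close> kills all terms with the metric, and
  along a geodesic the contraction of the third covariant derivative is the ordinary third
  derivative of \<open>\<lambda> \<circ> \<gamma>\<close>. So \<open>\<lambda> \<circ> \<gamma>\<close> is a polynomial of degree at most two
  (\<open>tanno_third_derivative_along_null_geodesic\<close>). By completeness \<open>\<gamma>\<close> is defined on the whole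
  line, and \<open>\<lambda> \<circ> \<gamma>\<close> is bounded because the manifold is compact; hence it is constant
  (\<open>bounded_third_derivative_zero\<close>). A geodesic starts at every point in every null direction, so the
  differential of \<open>\<lambda>\<close> vanishes on all null vectors (\<open>tanno_derivative_zero_on_null_vectors\<close>).

  At a point where the metric takes both signs the null vectors span the tangent space
  (\<open>functional_zero_on_null_vectors\<close>). A nondegenerate metric on a connected manifold that is
  definite at one point is definite everywhere, with the same sign (\<open>positive_definite_everywhere\<close>), so
  a metric of indefinite signature takes both signs at every point. Hence the differential of \<open>\<lambda>\<close> is
  zero, and \<open>\<lambda>\<close> is constant by connectedness.

  The existence of geodesics takes most of the work. In one chart the geodesic is a solution of an
  ordinary differential equation (\<open>picard_lindelof_local\<close>), smooth because the vector field
  is. That it satisfies the geodesic equation in all other charts is shown by way of the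
  Euler--Lagrange equation of the energy (\<open>geodesic_equation_iff_euler_lagrange\<close>,
  \<open>euler_lagrange_chart_change\<close>). This form involves no Christoffel symbols, so their
  transformation law is avoided; of the second derivatives of the change of chart only the
  symmetry matters. The Euler--Lagrange equation also gives at once that the velocity of a
  geodesic stays null.
\<close>

section \<open>Calculus of finitely often differentiable maps\<close>

lemma has_derivative_open_cong:
  assumes "open S" "x \<in> S" "\<And>y. y \<in> S \<Longrightarrow> f y = h y"
  shows "(f has_derivative f') (at x) \<longleftrightarrow> (h has_derivative f') (at x)"
  using assms has_derivative_transform_within_open[of f f' x UNIV S h]
      has_derivative_transform_within_open[of h f' x UNIV S f] by auto

lemma frechet_derivative_open_cong:
  assumes "open S" "x \<in> S" "\<And>y. y \<in> S \<Longrightarrow> f y = h y"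
  shows "frechet_derivative f (at x) = frechet_derivative h (at x)"
  using has_derivative_open_cong[OF assms] by (simp add: frechet_derivative_def)

lemma C_k_on_cong:
  assumes "open S" "\<And>x. x \<in> S \<Longrightarrow> f x = h x"
  shows "C_k_on k S f \<longleftrightarrow> C_k_on k S h"
  using assms(2)
proof (induction k arbitrary: f h)
  case 0
  then show ?case by (simp cong: continuous_on_cong)
next
  case (Suc k)
  have "f differentiable (at x) \<longleftrightarrow> h differentiable (at x)" if "x \<in> S" for x
    unfolding differentiable_def
    using has_derivative_open_cong[OF assms(1) that, of f h] Suc.prems by simp
  moreover have "C_k_on k S (\<lambda>x. frechet_derivative f (at x) v) \<longleftrightarrow>
      C_k_on k S (\<lambda>x. frechet_derivative h (at x) v)" for v
    by (rule Suc.IH) (simp add: frechet_derivative_open_cong[OF assms(1) _ Suc.prems])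
  ultimately show ?case by auto
qed

lemma C_k_on_SucI:
  assumes "open S" "\<And>x. x \<in> S \<Longrightarrow> (f has_derivative f' x) (at x)"
    and "\<And>v. C_k_on k S (\<lambda>x. f' x v)"
  shows "C_k_on (Suc k) S f"
proof -
  have "frechet_derivative f (at x) v = f' x v" if "x \<in> S" for x v
    using frechet_derivative_at[OF assms(2)[OF that]] by simp
  then have "C_k_on k S (\<lambda>x. frechet_derivative f (at x) v)" for v
    using C_k_on_cong[OF assms(1), of "\<lambda>x. frechet_derivative f (at x) v" "\<lambda>x. f' x v" k]
      assms(3)[of v] by simp
  then show ?thesis using assms(2) by (auto simp: differentiable_def)
qed

lemma C_k_on_Suc_has_derivative:
  assumes "C_k_on (Suc k) S f" "x \<in> S"
  shows "(f has_derivative frechet_derivative f (at x)) (at x)"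
  using assms frechet_derivative_works by auto

lemma C_k_on_SucD: "C_k_on (Suc k) S f \<Longrightarrow> C_k_on k S f"
proof (induction k arbitrary: f)
  case 0
  then show ?case
    by (auto intro!: continuous_at_imp_continuous_on differentiable_imp_continuous_within)
next
  case (Suc k)
  then show ?case by simp
qed

lemma C_k_on_subset: "C_k_on k S f \<Longrightarrow> T \<subseteq> S \<Longrightarrow> C_k_on k T f"
  by (induction k arbitrary: f) (auto intro: continuous_on_subset)

lemma C_k_on_const: "open S \<Longrightarrow> C_k_on k S (\<lambda>x. c)"
proof (induction k arbitrary: c)
  case (Suc k)
  show ?case
    by (rule C_k_on_SucI[OF Suc.prems, where f' = "\<lambda>x v. 0"]) (auto intro: Suc)
qed simp

lemma C_k_on_bounded_linear_comp:
  assumes "open S" "bounded_linear h" "C_k_on k S f"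
  shows "C_k_on k S (\<lambda>x. h (f x))"
  using assms(3)
proof (induction k arbitrary: f)
  case 0
  then show ?case
    using assms(2) by (auto intro: bounded_linear.continuous_on)
next
  case (Suc k)
  show ?case
    by (rule C_k_on_SucI[OF assms(1), where f' = "\<lambda>x v. h (frechet_derivative f (at x) v)"])
      (use Suc in \<open>auto intro!: bounded_linear.has_derivative[OF assms(2)]
         simp: frechet_derivative_works[symmetric]\<close>)
qed

lemma C_k_on_linear:
  fixes h :: "'a::real_normed_vector \<Rightarrow> 'b::real_normed_vector"
  assumes "open S" "bounded_linear h"
  shows "C_k_on k S h"
proof -
  have "C_k_on k S (\<lambda>x. x :: 'a)"
  proof (cases k)
    case (Suc m)
    show ?thesis unfolding Suc
      by (rule C_k_on_SucI[OF assms(1), where f' = "\<lambda>x v. v"])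
        (auto intro: C_k_on_const[OF assms(1)])
  qed simp
  then show ?thesis by (rule C_k_on_bounded_linear_comp[OF assms])
qed

lemma C_k_on_add:
  assumes "open S" "C_k_on k S f" "C_k_on k S h"
  shows "C_k_on k S (\<lambda>x. f x + h x)"
  using assms(2,3)
proof (induction k arbitrary: f h)
  case 0
  then show ?case by (auto intro: continuous_on_add)
next
  case (Suc k)
  show ?case
    by (rule C_k_on_SucI[OF assms(1), where
          f' = "\<lambda>x v. frechet_derivative f (at x) v + frechet_derivative h (at x) v"])
      (use Suc in \<open>auto intro!: has_derivative_add simp: frechet_derivative_works[symmetric]\<close>)
qed

lemma C_k_on_minus:
  assumes "open S" "C_k_on k S f"
  shows "C_k_on k S (\<lambda>x. - f x)"
  by (rule C_k_on_bounded_linear_comp[OF assms(1) _ assms(2)])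
    (rule bounded_linear_minus[OF bounded_linear_ident])

lemma C_k_on_diff:
  assumes "open S" "C_k_on k S f" "C_k_on k S h"
  shows "C_k_on k S (\<lambda>x. f x - h x)"
  using C_k_on_add[OF assms(1,2) C_k_on_minus[OF assms(1,3)]] by simp

lemma C_k_on_sum:
  assumes "open S" "\<And>i. i \<in> I \<Longrightarrow> C_k_on k S (f i)"
  shows "C_k_on k S (\<lambda>x. \<Sum>i\<in>I. f i x)"
  using assms(2)
  by (induction I rule: infinite_finite_induct)
    (auto intro: C_k_on_const[OF assms(1)] C_k_on_add[OF assms(1)])

lemma C_k_on_bilinear:
  assumes "open S" "bounded_bilinear b" "C_k_on k S f" "C_k_on k S h"
  shows "C_k_on k S (\<lambda>x. b (f x) (h x))"
  using assms(3,4)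
proof (induction k arbitrary: f h)
  case 0
  then show ?case by (auto intro: bounded_bilinear.continuous_on[OF assms(2)])
next
  case (Suc k)
  show ?case
    by (rule C_k_on_SucI[OF assms(1), where
          f' = "\<lambda>x v. b (f x) (frechet_derivative h (at x) v)
                + b (frechet_derivative f (at x) v) (h x)"])
      (use Suc C_k_on_SucD[OF Suc.prems(1)] C_k_on_SucD[OF Suc.prems(2)] in
        \<open>auto intro!: bounded_bilinear.FDERIV[OF assms(2)] C_k_on_add[OF assms(1)]
         simp: frechet_derivative_works[symmetric]\<close>)
qed

lemmas C_k_on_mult = C_k_on_bilinear[OF _ bounded_bilinear_mult]
lemmas C_k_on_scaleR = C_k_on_bilinear[OF _ bounded_bilinear_scaleR]
lemmas C_k_on_inner = C_k_on_bilinear[OF _ bounded_bilinear_inner]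

lemma C_k_on_prod:
  fixes f :: "'i \<Rightarrow> 'a::real_normed_vector \<Rightarrow> real"
  assumes "open S" "\<And>i. i \<in> I \<Longrightarrow> C_k_on k S (f i)"
  shows "C_k_on k S (\<lambda>x. \<Prod>i\<in>I. f i x)"
  using assms(2)
  by (induction I rule: infinite_finite_induct)
    (auto intro: C_k_on_const[OF assms(1)] C_k_on_mult[OF assms(1)])

lemma linear_expand_Basis:
  fixes v :: "'a::euclidean_space"
  assumes "bounded_linear h"
  shows "h v = (\<Sum>b\<in>Basis. (v \<bullet> b) *\<^sub>R h b)"
proof -
  interpret bounded_linear h by fact
  have "h v = h (\<Sum>b\<in>Basis. (v \<bullet> b) *\<^sub>R b)" by (simp add: euclidean_representation)
  also have "\<dots> = (\<Sum>b\<in>Basis. (v \<bullet> b) *\<^sub>R h b)" by (simp add: sum scaleR)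
  finally show ?thesis .
qed

text \<open>By induction on the order: the first derivative of the composition is a sum of products of first
  derivatives of \<open>h\<close> with first derivatives of \<open>f\<close> composed with \<open>h\<close>, and the induction hypothesis
  applies to these.\<close>

lemma C_k_on_compose:
  fixes f :: "'b::euclidean_space \<Rightarrow> 'c::real_normed_vector"
    and h :: "'a::real_normed_vector \<Rightarrow> 'b"
  assumes "open S" "open T" "h ` S \<subseteq> T" "C_k_on k T f" "C_k_on k S h"
  shows "C_k_on k S (\<lambda>x. f (h x))"
  using assms(4,5)
proof (induction k arbitrary: f)
  case 0
  then show ?case using assms(3) by (auto intro: continuous_on_compose2)
next
  case (Suc k)
  let ?f' = "\<lambda>x v. frechet_derivative f (at (h x)) (frechet_derivative h (at x) v)"
  have fd: "(f has_derivative frechet_derivative f (at (h x))) (at (h x))" if "x \<in> S" for x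
    using Suc.prems(1) that assms(3) by (intro C_k_on_Suc_has_derivative) auto
  show ?case
  proof (rule C_k_on_SucI[OF assms(1), where f' = ?f'])
    fix x assume x: "x \<in> S"
    show "((\<lambda>x. f (h x)) has_derivative ?f' x) (at x)"
      by (rule has_derivative_compose[OF C_k_on_Suc_has_derivative[OF Suc.prems(2) x]])
        (rule fd[OF x])
  next
    fix v
    \<comment> \<open>the derivative of \<open>f\<close> is taken in a direction that moves with the base point; in a basis it
      becomes a combination of derivatives of \<open>f\<close> in fixed directions\<close>
    have eq: "?f' x v = (\<Sum>b\<in>Basis. (frechet_derivative h (at x) v \<bullet> b) *\<^sub>R
        frechet_derivative f (at (h x)) b)" if "x \<in> S" for x
      by (rule linear_expand_Basis[OF has_derivative_bounded_linear[OF fd[OF that]]])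
    have "C_k_on k S (\<lambda>x. (frechet_derivative h (at x) v \<bullet> b) *\<^sub>R
        frechet_derivative f (at (h x)) b)" for b
      by (intro C_k_on_scaleR[OF assms(1)] C_k_on_inner[OF assms(1)] C_k_on_const[OF assms(1)]
          Suc.IH[where f = "\<lambda>y. frechet_derivative f (at y) b"])
        (use Suc.prems C_k_on_SucD[OF Suc.prems(2)] in auto)
    then have "C_k_on k S (\<lambda>x. \<Sum>b\<in>Basis. (frechet_derivative h (at x) v \<bullet> b) *\<^sub>R
        frechet_derivative f (at (h x)) b)"
      by (intro C_k_on_sum[OF assms(1)])
    then show "C_k_on k S (\<lambda>x. ?f' x v)"
      by (subst C_k_on_cong[OF assms(1) eq])
  qed
qed

lemma C_k_on_Pair:
  assumes "open S" "C_k_on k S f" "C_k_on k S h"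
  shows "C_k_on k S (\<lambda>x. (f x, h x))"
proof -
  have "bounded_linear (\<lambda>y. (y, 0))" "bounded_linear (\<lambda>z. (0, z))"
    by (auto intro!: bounded_linear_Pair bounded_linear_ident bounded_linear_zero)
  then have "C_k_on k S (\<lambda>x. (f x, 0) + (0, h x))"
    using assms by (intro C_k_on_add C_k_on_bounded_linear_comp[where h = "\<lambda>y. (y, 0)"]
        C_k_on_bounded_linear_comp[where h = "\<lambda>z. (0, z)"])
  then show ?thesis by simp
qed

lemma C_k_on_vec_lambda:
  assumes "open S" "\<And>i. C_k_on k S (f i)"
  shows "C_k_on k S (\<lambda>x. (\<chi> i. f i x) :: real^'n::finite)"
proof -
  have "(\<chi> i. f i x) = (\<Sum>i\<in>UNIV. f i x *\<^sub>R axis i 1)" for x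
    by (simp add: vec_eq_iff axis_def if_distrib cong: if_cong)
  then show ?thesis
    using assms by (auto intro!: C_k_on_sum C_k_on_scaleR C_k_on_const)
qed

lemma C_k_on_vec_nth:
  assumes "open S" "C_k_on k S f"
  shows "C_k_on k S (\<lambda>x. f x $ i)"
  using C_k_on_bounded_linear_comp[OF assms(1) bounded_linear_vec_nth assms(2)] .

lemma C_k_on_inverse:
  fixes f :: "'a::real_normed_vector \<Rightarrow> real"
  assumes "open S" "C_k_on k S f" "\<And>x. x \<in> S \<Longrightarrow> f x \<noteq> 0"
  shows "C_k_on k S (\<lambda>x. inverse (f x))"
  using assms(2)
proof (induction k)
  case 0
  then show ?case using assms(3) by (auto intro: continuous_on_inverse)
next
  case (Suc k)
  have IH: "C_k_on k S (\<lambda>x. inverse (f x))"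
    by (rule Suc.IH[OF C_k_on_SucD[OF Suc.prems]])
  show ?case
  proof (rule C_k_on_SucI[OF assms(1), where
        f' = "\<lambda>x v. - (inverse (f x) * frechet_derivative f (at x) v * inverse (f x))"])
    fix x assume "x \<in> S"
    then show "((\<lambda>x. inverse (f x)) has_derivative
        (\<lambda>v. - (inverse (f x) * frechet_derivative f (at x) v * inverse (f x)))) (at x)"
      using C_k_on_Suc_has_derivative[OF Suc.prems] assms(3)
      by (intro Deriv.has_derivative_inverse)
  next
    fix v
    show "C_k_on k S (\<lambda>x. - (inverse (f x) * frechet_derivative f (at x) v * inverse (f x)))"
      using Suc.prems by (intro C_k_on_minus C_k_on_mult assms(1) IH) auto
  qed
qed

lemma C_k_on_det:
  fixes M :: "'a::real_normed_vector \<Rightarrow> real^'n::finite^'n"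
  assumes "open S" "\<And>i j. C_k_on k S (\<lambda>x. M x $ i $ j)"
  shows "C_k_on k S (\<lambda>x. det (M x))"
  unfolding det_def
  by (intro C_k_on_sum C_k_on_mult C_k_on_prod C_k_on_const assms)

lemma matrix_inv_right:
  fixes M :: "real^'n::finite^'n"
  assumes "invertible M"
  shows "M ** matrix_inv M = mat 1"
  using assms unfolding invertible_def matrix_inv_def by (rule someI2_ex) simp

lemma matrix_inv_left:
  fixes M :: "real^'n::finite^'n"
  assumes "invertible M"
  shows "matrix_inv M ** M = mat 1"
  using assms unfolding invertible_def matrix_inv_def by (rule someI2_ex) simp

text \<open>Cramer's rule makes the entries of the inverse matrix rational functions of the entries, and
  thereby as smooth as the matrix itself.\<close>

lemma matrix_inv_cramer:
  fixes M :: "real^'n::finite^'n"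
  assumes "invertible M"
  shows "matrix_inv M $ k $ l = det (\<chi> i j. if j = k then axis l 1 $ i else M $ i $ j) / det M"
proof -
  have "det M \<noteq> 0" using assms by (simp add: invertible_det_nz)
  moreover have "M *v column l (matrix_inv M) = axis l 1"
  proof -
    have "(M ** matrix_inv M) $ i $ l = (axis l 1 :: real^'n) $ i" for i
      by (simp add: matrix_inv_right[OF assms] mat_def axis_def)
    then show ?thesis
      by (simp add: vec_eq_iff matrix_matrix_mult_def matrix_vector_mult_def column_def)
  qed
  ultimately have "column l (matrix_inv M) =
      (\<chi> k. det (\<chi> i j. if j = k then axis l 1 $ i else M $ i $ j) / det M)"
    by (simp add: cramer)
  then show ?thesis by (simp add: vec_eq_iff column_def)
qed

lemma C_k_on_matrix_inv:
  fixes M :: "'a::real_normed_vector \<Rightarrow> real^'n::finite^'n"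
  assumes "open S" "\<And>i j. C_k_on k S (\<lambda>x. M x $ i $ j)" "\<And>x. x \<in> S \<Longrightarrow> invertible (M x)"
  shows "C_k_on k S (\<lambda>x. matrix_inv (M x) $ p $ q)"
proof -
  let ?c = "\<lambda>x. det (\<chi> i j. if j = p then axis q 1 $ i else M x $ i $ j) * inverse (det (M x))"
  have "C_k_on k S ?c"
  proof (intro C_k_on_mult C_k_on_det C_k_on_inverse assms(1,2))
    fix i j
    show "C_k_on k S (\<lambda>x. (\<chi> i j. if j = p then axis q 1 $ i else M x $ i $ j) $ i $ j)"
      using assms by (cases "j = p") (auto intro: C_k_on_const)
  next
    fix x assume "x \<in> S"
    then show "det (M x) \<noteq> 0" using assms(3) by (simp add: invertible_det_nz)
  qed
  then show ?thesis
    using C_k_on_cong[OF assms(1), of ?c "\<lambda>x. matrix_inv (M x) $ p $ q"] assms(3)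
    by (simp add: matrix_inv_cramer divide_inverse)
qed

lemma smooth_on_has_derivative:
  assumes "smooth_on S f" "x \<in> S"
  shows "(f has_derivative frechet_derivative f (at x)) (at x)"
  using assms C_k_on_Suc_has_derivative unfolding smooth_on_def by blast

lemma smooth_on_imp_continuous_on: "smooth_on S f \<Longrightarrow> continuous_on S f"
  using C_k_on.simps(1) unfolding smooth_on_def by blast

lemma smooth_on_frechet_derivative:
  assumes "smooth_on S f"
  shows "smooth_on S (\<lambda>x. frechet_derivative f (at x) v)"
  using assms C_k_on.simps(2) unfolding smooth_on_def by blast

lemma smooth_on_subset: "smooth_on S f \<Longrightarrow> T \<subseteq> S \<Longrightarrow> smooth_on T f"
  using C_k_on_subset unfolding smooth_on_def by blast

lemma smooth_on_cong:
  assumes "open S" "\<And>x. x \<in> S \<Longrightarrow> f x = h x"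
  shows "smooth_on S f \<longleftrightarrow> smooth_on S h"
  using C_k_on_cong[OF assms(1), of f h] assms(2) unfolding smooth_on_def by simp

lemma smooth_on_compose:
  fixes f :: "'b::euclidean_space \<Rightarrow> 'c::real_normed_vector"
    and h :: "'a::real_normed_vector \<Rightarrow> 'b"
  assumes "open S" "open T" "h ` S \<subseteq> T" "smooth_on T f" "smooth_on S h"
  shows "smooth_on S (\<lambda>x. f (h x))"
  using C_k_on_compose[OF assms(1-3)] assms(4,5) unfolding smooth_on_def by blast

lemma smooth_on_pderiv_at:
  assumes "smooth_on S f"
  shows "smooth_on S (pderiv_at i f)"
  using smooth_on_frechet_derivative[OF assms] unfolding pderiv_at_def .

lemma smooth_on_christoffel:
  fixes G :: "real^'n::finite \<Rightarrow> real^'n^'n"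
  assumes "open S" "smooth_on S G" "\<And>x. x \<in> S \<Longrightarrow> invertible (G x)"
  shows "smooth_on S (christoffel G k i j)"
proof -
  have G: "smooth_on S (\<lambda>y. G y $ p $ q)" for p q
    using assms(2) C_k_on_vec_nth[OF assms(1) C_k_on_bounded_linear_comp[OF assms(1)
        bounded_linear_vec_nth]] unfolding smooth_on_def by blast
  have "smooth_on S (\<lambda>x. matrix_inv (G x) $ k $ l)" for l
    using C_k_on_matrix_inv[OF assms(1), of _ G] assms(3) G unfolding smooth_on_def by simp
  then show ?thesis
    unfolding smooth_on_def christoffel_def
    using smooth_on_pderiv_at[OF G] assms(1)
    by (intro allI C_k_on_mult C_k_on_const C_k_on_sum C_k_on_diff C_k_on_add)
       (auto simp: smooth_on_def)
qed

section \<open>Symmetry of the second derivative\<close>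

lemma has_real_derivative_along_line:
  fixes f :: "'a::real_normed_vector \<Rightarrow> real"
  assumes "(f has_derivative f') (at (p + s *\<^sub>R v))"
  shows "((\<lambda>s. f (p + s *\<^sub>R v)) has_real_derivative f' v) (at s)"
proof -
  have "((\<lambda>s. p + s *\<^sub>R v) has_derivative (\<lambda>h. h *\<^sub>R v)) (at s)"
    by (auto intro!: derivative_eq_intros)
  from has_derivative_compose[OF this assms]
  have "((\<lambda>s. f (p + s *\<^sub>R v)) has_derivative (\<lambda>h. f' (h *\<^sub>R v))) (at s)" .
  moreover have "f' (h *\<^sub>R v) = f' v * h" for h
    using linear_simps(5)[OF has_derivative_bounded_linear[OF assms]] by simp
  ultimately show ?thesis by (simp add: has_field_derivative_def)
qed

text \<open>The mean value theorem, applied once in each direction to the mixed second difference. This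
  difference is symmetric in \<open>v\<close> and \<open>w\<close>, which is what makes the second derivative symmetric.\<close>

lemma second_difference_mean_value:
  fixes f :: "'a::real_normed_vector \<Rightarrow> real"
  assumes C2: "C_k_on (Suc (Suc 0)) (ball x e) f" and h: "0 < h" "h * (norm v + norm w) < e"
  shows "\<exists>y. dist y x \<le> h * (norm v + norm w) \<and>
    f (x + h *\<^sub>R v + h *\<^sub>R w) - f (x + h *\<^sub>R v) - f (x + h *\<^sub>R w) + f x =
    h * h * frechet_derivative (\<lambda>y. frechet_derivative f (at y) v) (at y) w"
proof -
  let ?D = "\<lambda>y. frechet_derivative f (at y)"
  let ?DD = "\<lambda>y. frechet_derivative (\<lambda>y. frechet_derivative f (at y) v) (at y)"
  have near: "norm (s *\<^sub>R v + t *\<^sub>R w) \<le> h * (norm v + norm w)"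
    if "0 \<le> s" "s \<le> h" "0 \<le> t" "t \<le> h" for s t
  proof -
    have "norm (s *\<^sub>R v + t *\<^sub>R w) \<le> s * norm v + t * norm w"
      using norm_triangle_ineq[of "s *\<^sub>R v" "t *\<^sub>R w"] that by simp
    also have "\<dots> \<le> h * norm v + h * norm w"
      using that by (intro add_mono mult_right_mono) auto
    finally show ?thesis by (simp add: algebra_simps)
  qed
  have inb: "x + s *\<^sub>R v + t *\<^sub>R w \<in> ball x e" if "0 \<le> s" "s \<le> h" "0 \<le> t" "t \<le> h" for s t
  proof -
    have "dist x (x + s *\<^sub>R v + t *\<^sub>R w) = norm (s *\<^sub>R v + t *\<^sub>R w)"
      using norm_minus_cancel[of "s *\<^sub>R v + t *\<^sub>R w"] by (simp add: dist_norm add.assoc del: norm_minus_cancel)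
    then show ?thesis using near[OF that] h by simp
  qed
  have D: "(f has_derivative ?D y) (at y)" if "y \<in> ball x e" for y
    using C_k_on_Suc_has_derivative[OF C2 that] .
  have DD: "((\<lambda>y. ?D y v) has_derivative ?DD y) (at y)" if "y \<in> ball x e" for y
  proof -
    have "C_k_on (Suc 0) (ball x e) (\<lambda>y. ?D y v)" using C2 by simp
    from C_k_on_Suc_has_derivative[OF this that] show ?thesis .
  qed
  have ds: "((\<lambda>s. f (x + s *\<^sub>R v + t *\<^sub>R w)) has_real_derivative ?D (x + s *\<^sub>R v + t *\<^sub>R w) v) (at s)"
    if "0 \<le> s" "s \<le> h" "0 \<le> t" "t \<le> h" for s t
    using has_real_derivative_along_line[of f "?D (x + s *\<^sub>R v + t *\<^sub>R w)" "x + t *\<^sub>R w" s v]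
      D[OF inb[OF that]] by (simp add: algebra_simps)
  have "\<exists>\<xi>. 0 < \<xi> \<and> \<xi> < h \<and>
     (f (x + h *\<^sub>R v + h *\<^sub>R w) - f (x + h *\<^sub>R v + 0 *\<^sub>R w)) - (f (x + 0 *\<^sub>R v + h *\<^sub>R w) - f (x + 0 *\<^sub>R v + 0 *\<^sub>R w)) =
     (h - 0) * (?D (x + \<xi> *\<^sub>R v + h *\<^sub>R w) v - ?D (x + \<xi> *\<^sub>R v + 0 *\<^sub>R w) v)"
    by (rule MVT2) (use h in \<open>auto intro!: DERIV_diff ds simp del: scaleR_zero_left\<close>)
  then obtain \<xi> where xi: "0 < \<xi>" "\<xi> < h" and eq1:
    "f (x + h *\<^sub>R v + h *\<^sub>R w) - f (x + h *\<^sub>R v) - f (x + h *\<^sub>R w) + f x =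
      h * (?D (x + \<xi> *\<^sub>R v + h *\<^sub>R w) v - ?D (x + \<xi> *\<^sub>R v + 0 *\<^sub>R w) v)"
    by (auto simp: algebra_simps)
  have dt: "((\<lambda>t. ?D (x + \<xi> *\<^sub>R v + t *\<^sub>R w) v) has_real_derivative
      ?DD (x + \<xi> *\<^sub>R v + t *\<^sub>R w) w) (at t)" if "0 \<le> t" "t \<le> h" for t
    by (rule has_real_derivative_along_line[where f = "\<lambda>y. ?D y v"])
      (use DD inb that xi in simp)
  have "\<exists>\<eta>. 0 < \<eta> \<and> \<eta> < h \<and> ?D (x + \<xi> *\<^sub>R v + h *\<^sub>R w) v - ?D (x + \<xi> *\<^sub>R v + 0 *\<^sub>R w) v =
      (h - 0) * ?DD (x + \<xi> *\<^sub>R v + \<eta> *\<^sub>R w) w"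
    by (rule MVT2) (use h dt in auto)
  then obtain \<eta> where eta: "0 < \<eta>" "\<eta> < h" and eq2:
    "?D (x + \<xi> *\<^sub>R v + h *\<^sub>R w) v - ?D (x + \<xi> *\<^sub>R v + 0 *\<^sub>R w) v = h * ?DD (x + \<xi> *\<^sub>R v + \<eta> *\<^sub>R w) w"
    by auto
  show ?thesis
  proof (intro exI conjI)
    show "dist (x + \<xi> *\<^sub>R v + \<eta> *\<^sub>R w) x \<le> h * (norm v + norm w)"
      using near[of \<xi> \<eta>] xi eta by (simp add: dist_norm add.assoc)
    show "f (x + h *\<^sub>R v + h *\<^sub>R w) - f (x + h *\<^sub>R v) - f (x + h *\<^sub>R w) + f x =
        h * h * ?DD (x + \<xi> *\<^sub>R v + \<eta> *\<^sub>R w) w"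
      unfolding eq1 eq2 by simp
  qed
qed

lemma second_derivative_symmetric_real:
  fixes f :: "'a::real_normed_vector \<Rightarrow> real"
  assumes "open S" "x \<in> S" and C2: "C_k_on (Suc (Suc 0)) S f"
  shows "frechet_derivative (\<lambda>y. frechet_derivative f (at y) v) (at x) w =
    frechet_derivative (\<lambda>y. frechet_derivative f (at y) w) (at x) v"
proof -
  let ?P = "\<lambda>v w y. frechet_derivative (\<lambda>y. frechet_derivative f (at y) v) (at y) w"
  have close: "\<exists>d>0. \<forall>y. dist y x < d \<longrightarrow> \<bar>?P v w y - ?P v w x\<bar> < \<epsilon>" if "\<epsilon> > 0" for v w \<epsilon>
  proof -
    have "continuous_on S (?P v w)" using C2 by simp
    then have "isCont (?P v w) x" using assms(1,2) by (simp add: continuous_on_eq_continuous_at)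
    then show ?thesis using that unfolding continuous_at_eps_delta by (simp add: dist_real_def)
  qed
  have "\<bar>?P v w x - ?P w v x\<bar> \<le> \<epsilon>" if eps: "\<epsilon> > 0" for \<epsilon>
  proof -
    obtain d1 where d1: "d1 > 0" "\<And>y. dist y x < d1 \<Longrightarrow> \<bar>?P v w y - ?P v w x\<bar> < \<epsilon> / 2"
      using close[of "\<epsilon> / 2" v w] eps by auto
    obtain d2 where d2: "d2 > 0" "\<And>y. dist y x < d2 \<Longrightarrow> \<bar>?P w v y - ?P w v x\<bar> < \<epsilon> / 2"
      using close[of "\<epsilon> / 2" w v] eps by auto
    obtain e where e: "e > 0" "ball x e \<subseteq> S" using assms(1,2) open_contains_ball by blast
    define d where "d = min e (min d1 d2)"
    have d: "d > 0" "d \<le> e" "d \<le> d1" "d \<le> d2" using d1 d2 e by (auto simp: d_def)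
    define h where "h = d / (2 * (norm v + norm w + 1))"
    have pos: "norm v + norm w + 1 > 0" by (simp add: add_nonneg_pos)
    then have h: "h > 0" using d by (simp add: h_def)
    have "h * (norm v + norm w) \<le> h * (norm v + norm w + 1)" using h by simp
    also have "\<dots> = d / 2" using pos by (simp add: h_def field_simps)
    finally have hd: "h * (norm v + norm w) < d" using d by simp
    have C2b: "C_k_on (Suc (Suc 0)) (ball x e) f" by (rule C_k_on_subset[OF C2 e(2)])
    have he: "h * (norm v + norm w) < e" "h * (norm w + norm v) < e"
      using hd d by (simp_all add: add.commute)
    obtain y where y: "dist y x \<le> h * (norm v + norm w)"
      "f (x + h *\<^sub>R v + h *\<^sub>R w) - f (x + h *\<^sub>R v) - f (x + h *\<^sub>R w) + f x = h * h * ?P v w y"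
      using second_difference_mean_value[OF C2b h he(1)] by blast
    obtain z where z: "dist z x \<le> h * (norm w + norm v)"
      "f (x + h *\<^sub>R w + h *\<^sub>R v) - f (x + h *\<^sub>R w) - f (x + h *\<^sub>R v) + f x = h * h * ?P w v z"
      using second_difference_mean_value[OF C2b h he(2)] by blast
    have yz: "dist y x < d" "dist z x < d" using y(1) z(1) hd by (simp_all add: add.commute)
    have "h * h * ?P v w y = h * h * ?P w v z"
      using y(2) z(2) by (simp add: algebra_simps)
    then have "?P v w y = ?P w v z" using h by simp
    moreover have "\<bar>?P v w y - ?P v w x\<bar> < \<epsilon> / 2" "\<bar>?P w v z - ?P w v x\<bar> < \<epsilon> / 2"
      using d1(2)[of y] d2(2)[of z] yz d by auto
    ultimately show ?thesis by linarith
  qed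
  then have "\<bar>?P v w x - ?P w v x\<bar> \<le> 0"
    by (meson field_le_epsilon add_0 le_less_trans not_le dense)
  then show ?thesis by simp
qed

lemma frechet_derivative_bounded_linear_comp:
  assumes "bounded_linear h" "f differentiable (at x)"
  shows "frechet_derivative (\<lambda>y. h (f y)) (at x) v = h (frechet_derivative f (at x) v)"
  using frechet_derivative_at[OF bounded_linear.has_derivative[OF assms(1),
        OF assms(2)[unfolded frechet_derivative_works]]] by metis

lemma second_derivative_symmetric:
  fixes f :: "'a::real_normed_vector \<Rightarrow> 'b::real_inner"
  assumes S: "open S" "x \<in> S" and C2: "C_k_on (Suc (Suc 0)) S f"
  shows "frechet_derivative (\<lambda>y. frechet_derivative f (at y) v) (at x) w =
    frechet_derivative (\<lambda>y. frechet_derivative f (at y) w) (at x) v"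
proof -
  have "frechet_derivative (\<lambda>y. frechet_derivative f (at y) v) (at x) w \<bullet> c =
      frechet_derivative (\<lambda>y. frechet_derivative f (at y) w) (at x) v \<bullet> c" for c
  proof -
    have bl: "bounded_linear (\<lambda>y. y \<bullet> c)" by (rule bounded_linear_inner_left)
    have second: "frechet_derivative (\<lambda>y. frechet_derivative (\<lambda>y. f y \<bullet> c) (at y) v) (at x) w =
        frechet_derivative (\<lambda>y. frechet_derivative f (at y) v) (at x) w \<bullet> c" for v w
    proof -
      have "frechet_derivative (\<lambda>y. frechet_derivative (\<lambda>y. f y \<bullet> c) (at y) v) (at x) =
          frechet_derivative (\<lambda>y. frechet_derivative f (at y) v \<bullet> c) (at x)"
        by (rule frechet_derivative_open_cong[OF S])
          (use C2 in \<open>simp add: frechet_derivative_bounded_linear_comp[OF bl]\<close>)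
      then show ?thesis
        using C2 S(2) by (simp add: frechet_derivative_bounded_linear_comp[OF bl])
    qed
    have "C_k_on (Suc (Suc 0)) S (\<lambda>y. f y \<bullet> c)"
      by (rule C_k_on_bounded_linear_comp[OF S(1) bl C2])
    from second_derivative_symmetric_real[OF S this, of v w] show ?thesis
      unfolding second .
  qed
  then show ?thesis by (metis vector_eq_rdot)
qed

section \<open>Local solutions of ordinary differential equations\<close>

text \<open>Continuity is only known for the directional derivatives, so the operator norm of the derivative
  is bounded by the sum of their maxima over a basis.\<close>

lemma C1_imp_lipschitz_near:
  fixes F :: "'a::euclidean_space \<Rightarrow> 'b::real_normed_vector"
  assumes "open D" "x0 \<in> D" "C_k_on (Suc 0) D F"
  obtains r K where "r > 0" "K \<ge> 0" "cball x0 r \<subseteq> D"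
    "\<And>x y. x \<in> cball x0 r \<Longrightarrow> y \<in> cball x0 r \<Longrightarrow> norm (F x - F y) \<le> K * norm (x - y)"
proof -
  obtain r where r: "r > 0" "cball x0 r \<subseteq> D" using assms open_contains_cball by blast
  let ?F' = "\<lambda>x. frechet_derivative F (at x)"
  have F': "(F has_derivative ?F' x) (at x)" if "x \<in> cball x0 r" for x
    using C_k_on_Suc_has_derivative[OF assms(3)] that r by blast
  have "\<exists>M\<ge>0. \<forall>x\<in>cball x0 r. norm (?F' x b) \<le> M" for b
  proof -
    have "continuous_on (cball x0 r) (\<lambda>x. ?F' x b)"
      using assms(3) r by (auto intro: continuous_on_subset)
    then have "bounded ((\<lambda>x. ?F' x b) ` cball x0 r)"
      by (intro compact_imp_bounded compact_continuous_image) auto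
    then show ?thesis unfolding bounded_pos by (auto intro: less_imp_le)
  qed
  then obtain M where M: "\<And>b. M b \<ge> 0" "\<And>b x. x \<in> cball x0 r \<Longrightarrow> norm (?F' x b) \<le> M b"
    by metis
  have on: "onorm (?F' x) \<le> sum M Basis" if "x \<in> cball x0 r" for x
  proof (rule onorm_bound)
    show "0 \<le> sum M Basis" by (intro sum_nonneg M)
    fix v
    have "norm (?F' x v) = norm (\<Sum>b\<in>Basis. (v \<bullet> b) *\<^sub>R ?F' x b)"
      using linear_expand_Basis[OF has_derivative_bounded_linear[OF F'[OF that]], of v] by simp
    also have "\<dots> \<le> (\<Sum>b\<in>Basis. norm ((v \<bullet> b) *\<^sub>R ?F' x b))" by (rule norm_sum)
    also have "\<dots> \<le> (\<Sum>b\<in>Basis. norm v * M b)"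
      using Basis_le_norm[of _ v] M that by (intro sum_mono) (auto intro!: mult_mono)
    finally show "norm (?F' x v) \<le> sum M Basis * norm v"
      by (simp add: sum_distrib_left mult.commute)
  qed
  show thesis
  proof
    show "norm (F x - F y) \<le> sum M Basis * norm (x - y)"
      if "x \<in> cball x0 r" "y \<in> cball x0 r" for x y
      by (rule differentiable_bound[OF convex_cball has_derivative_at_withinI[OF F'] on that])
  qed (use r M in \<open>auto intro: sum_nonneg\<close>)
qed

text \<open>The Picard--Lindelof theorem, by Banach's fixed point theorem for the integral operator on
  continuous maps into the ball. The maps are defined on the whole line and the operator stops at
  \<open>\<plusminus>a\<close>; the integral starts at \<open>- a\<close> instead of \<open>0\<close> and is corrected by a constant, so both time
  directions are treated at once. This triples the bounds, hence the factors 3 and 6.\<close>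

theorem picard_lindelof_local:
  fixes F :: "'a::euclidean_space \<Rightarrow> 'a"
  assumes r: "r > 0" and K: "K \<ge> 0"
    and lip: "\<And>x y. x \<in> cball x0 r \<Longrightarrow> y \<in> cball x0 r \<Longrightarrow> norm (F x - F y) \<le> K * norm (x - y)"
  obtains a \<phi> where "a > 0" "\<phi> 0 = x0" "\<And>t. \<phi> t \<in> cball x0 r"
    "\<And>t. t \<in> {-a<..<a} \<Longrightarrow> (\<phi> has_vector_derivative F (\<phi> t)) (at t)"
proof -
  let ?B = "cball x0 r"
  have contF: "continuous_on ?B F"
    using lip K by (intro lipschitz_on_continuous_on[of K])
      (auto simp: lipschitz_on_def dist_norm)
  obtain M where M: "M \<ge> 0" "\<And>x. x \<in> ?B \<Longrightarrow> norm (F x) \<le> M"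
  proof -
    have "bounded (F ` ?B)"
      by (intro compact_imp_bounded compact_continuous_image contF) auto
    then have "\<exists>M\<ge>0. \<forall>x\<in>?B. norm (F x) \<le> M"
      unfolding bounded_pos by (auto intro: less_imp_le)
    then obtain M where "M \<ge> 0" "\<forall>x\<in>?B. norm (F x) \<le> M" by blast
    then show thesis using that[of M] by blast
  qed
  define a where "a = min (r / (3 * M + 1)) (1 / (6 * K + 1))"
  have a: "a > 0" using r M K by (simp add: a_def add_nonneg_pos)
  have "a * (3 * M + 1) \<le> r"
    using M by (simp add: a_def pos_le_divide_eq[symmetric] add_nonneg_pos)
  then have aM: "3 * a * M \<le> r" using a by (simp add: algebra_simps)
  have "a * (6 * K + 1) \<le> 1"
    using K by (simp add: a_def pos_le_divide_eq[symmetric] add_nonneg_pos)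
  then have aK: "3 * a * K \<le> 1/2" using a by (simp add: algebra_simps)
  define cl where "cl t = max (-a) (min a t)" for t :: real
  have cl: "cl t \<in> {-a..a}" for t using a by (auto simp: cl_def)
  have cl_id: "cl t = t" if "t \<in> {-a..a}" for t using that by (auto simp: cl_def)
  define Itg where "Itg f t = integral {-a..cl t} f - integral {-a..0} f" for f :: "real \<Rightarrow> 'a" and t
  have Itg_bound: "norm (Itg f t) \<le> 3 * a * C"
    if "continuous_on UNIV f" "\<And>t. norm (f t) \<le> C" for f t C
  proof -
    have C: "C \<ge> 0" using order_trans[OF norm_ge_zero that(2)] .
    have b: "norm (integral {-a..s} f) \<le> C * (s + a)" if "s \<ge> -a" for s
      using integral_bound[of "-a" s f C] that \<open>continuous_on UNIV f\<close> \<open>\<And>t. norm (f t) \<le> C\<close>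
      by (auto intro: continuous_on_subset)
    have "norm (Itg f t) \<le> C * (cl t + a) + C * (0 + a)"
      unfolding Itg_def using b[of "cl t"] b[of 0] cl[of t] a
      by (intro order_trans[OF norm_triangle_ineq4] add_mono) auto
    also have "\<dots> \<le> C * (a + a) + C * (0 + a)"
      using cl[of t] C by (intro add_mono mult_left_mono) auto
    finally show ?thesis by (simp add: algebra_simps)
  qed
  have Itg_cont: "continuous_on UNIV (Itg f)" if "continuous_on UNIV f" for f
  proof -
    have "continuous_on {-a..a} (\<lambda>s. integral {-a..s} f)"
      using that by (intro indefinite_integral_continuous_1 integrable_continuous_real)
        (auto intro: continuous_on_subset)
    moreover have "continuous_on UNIV cl"
      unfolding cl_def by (intro continuous_intros)
    ultimately have "continuous_on UNIV (\<lambda>t. integral {-a..cl t} f)"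
      by (rule continuous_on_compose2) (use cl in auto)
    then show ?thesis unfolding Itg_def by (intro continuous_intros)
  qed
  define V where "V = PiC (UNIV :: real set) (\<lambda>_. ?B)"
  have V: "f \<in> V \<longleftrightarrow> (\<forall>t. apply_bcontfun f t \<in> ?B)" for f
    by (auto simp: V_def mem_PiC_iff)
  have Fcont: "continuous_on UNIV (\<lambda>t. F (apply_bcontfun f t))" if "f \<in> V" for f
    using that V by (intro continuous_on_compose2[OF contF]) auto
  define T where "T f = Bcontfun (\<lambda>t. x0 + Itg (\<lambda>s. F (apply_bcontfun f s)) t)"
    for f :: "real \<Rightarrow>\<^sub>C 'a"
  have inB: "x0 + Itg (\<lambda>s. F (apply_bcontfun f s)) t \<in> ?B" if "f \<in> V" for f t
    using Itg_bound[OF Fcont[OF that], of M t] M(2) that V aM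
    by (fastforce simp: dist_norm)
  have Tapp: "apply_bcontfun (T f) t = x0 + Itg (\<lambda>s. F (apply_bcontfun f s)) t" if "f \<in> V" for f t
  proof -
    have "(\<lambda>t. x0 + Itg (\<lambda>s. F (apply_bcontfun f s)) t) \<in> bcontfun"
      using inB[OF that] unfolding bcontfun_def
      by (auto intro!: continuous_on_add continuous_on_const Itg_cont Fcont that
          bounded_subset[OF bounded_cball[of x0 r]])
    then show ?thesis by (simp add: T_def Bcontfun_inverse)
  qed
  have "\<exists>!f\<in>V. T f = f"
  proof (rule Banach_fix[where c = "1/2"])
    show "complete V" unfolding complete_eq_closed V_def by (intro closed_PiC) auto
    have "const_bcontfun x0 \<in> V" using r by (simp add: V const_bcontfun.rep_eq)
    then show "V \<noteq> {}" by blast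
    show "T ` V \<subseteq> V" using inB Tapp by (auto simp: V)
    fix f h assume fh: "f \<in> V" "h \<in> V"
    show "dist (T f) (T h) \<le> 1/2 * dist f h"
    proof (rule dist_bound)
      fix t
      let ?f = "\<lambda>s. F (apply_bcontfun f s)" and ?h = "\<lambda>s. F (apply_bcontfun h s)"
      have integ: "?f integrable_on {-a..s}" "?h integrable_on {-a..s}" for s
        using Fcont[OF fh(1)] Fcont[OF fh(2)]
        by (auto intro!: integrable_continuous_real intro: continuous_on_subset)
      have "Itg ?f t - Itg ?h t = Itg (\<lambda>s. ?f s - ?h s) t"
        unfolding Itg_def using integ by (simp add: Henstock_Kurzweil_Integration.integral_diff)
      moreover have "norm (Itg (\<lambda>s. ?f s - ?h s) t) \<le> 3 * a * (K * dist f h)"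
      proof (rule Itg_bound)
        show "continuous_on UNIV (\<lambda>s. ?f s - ?h s)"
          by (intro continuous_on_diff Fcont fh)
        fix s
        have "norm (?f s - ?h s) \<le> K * norm (apply_bcontfun f s - apply_bcontfun h s)"
          using fh by (intro lip) (auto simp: V)
        also have "\<dots> \<le> K * dist f h"
          using dist_bounded[of f s h] K by (intro mult_left_mono) (auto simp: dist_norm)
        finally show "norm (?f s - ?h s) \<le> K * dist f h" .
      qed
      moreover have "3 * a * (K * dist f h) \<le> 1/2 * dist f h"
        using mult_right_mono[OF aK zero_le_dist[of f h]] by (simp add: algebra_simps)
      ultimately show "dist (apply_bcontfun (T f) t) (apply_bcontfun (T h) t) \<le> 1/2 * dist f h"
        by (simp add: Tapp fh dist_norm)
    qed
  qed auto
  then obtain f where f: "f \<in> V" "T f = f" by blast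
  have feq: "apply_bcontfun f t = x0 + Itg (\<lambda>s. F (apply_bcontfun f s)) t" for t
    using Tapp[OF f(1), of t] unfolding f(2) .
  show thesis
  proof (rule that[OF a])
    show "apply_bcontfun f 0 = x0"
      using feq[of 0] a cl_id[of 0] by (simp add: Itg_def)
    show "apply_bcontfun f t \<in> ?B" for t using f V by blast
    fix t assume t: "t \<in> {-a<..<a}"
    let ?F = "\<lambda>s. F (apply_bcontfun f s)"
    have "((\<lambda>u. integral {-a..u} ?F) has_vector_derivative ?F t) (at t within {-a..a})"
      using t Fcont[OF f(1)]
      by (intro integral_has_vector_derivative) (auto intro: continuous_on_subset)
    then have "((\<lambda>u. integral {-a..u} ?F) has_vector_derivative ?F t) (at t)"
      using t by (simp add: at_within_Icc_at)
    then have "((\<lambda>u. x0 - integral {-a..0} ?F + integral {-a..u} ?F) has_vector_derivative ?F t) (at t)"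
      by (auto intro!: derivative_eq_intros)
    then show "(apply_bcontfun f has_vector_derivative ?F t) (at t)"
    proof (rule has_vector_derivative_transform_within_open[of _ _ _ "{-a<..<a}"])
      fix u assume "u \<in> {-a<..<a}"
      then show "x0 - integral {-a..0} ?F + integral {-a..u} ?F = apply_bcontfun f u"
        using feq[of u] cl_id[of u] by (simp add: Itg_def)
    qed (use t in auto)
  qed
qed

text \<open>The derivative of a solution is the vector field along it, hence as smooth as the solution
  itself: each order of smoothness gives the next one.\<close>

lemma smooth_on_ode_solution:
  fixes F :: "'a::euclidean_space \<Rightarrow> 'a"
  assumes "open I" "open D" "smooth_on D F" "\<And>t. t \<in> I \<Longrightarrow> \<phi> t \<in> D"
    and sol: "\<And>t. t \<in> I \<Longrightarrow> (\<phi> has_vector_derivative F (\<phi> t)) (at t)"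
  shows "smooth_on I \<phi>"
proof -
  have "C_k_on k I \<phi>" for k
  proof (induction k)
    case 0
    show ?case
      using sol by (auto intro!: continuous_at_imp_continuous_on has_vector_derivative_continuous)
  next
    case (Suc k)
    have "C_k_on k I (\<lambda>t. F (\<phi> t))"
      using assms(3,4) by (intro C_k_on_compose[OF assms(1,2) _ _ Suc]) (auto simp: smooth_on_def)
    then show ?case
      using sol by (intro C_k_on_SucI[OF assms(1), where f' = "\<lambda>t v. v *\<^sub>R F (\<phi> t)"]
          C_k_on_scaleR C_k_on_const assms(1)) (auto simp: has_vector_derivative_def)
  qed
  then show ?thesis by (simp add: smooth_on_def)
qed

theorem smooth_ode_local_solution:
  fixes F :: "'a::euclidean_space \<Rightarrow> 'a"
  assumes "open D" "x0 \<in> D" "smooth_on D F"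
  obtains a \<phi> where "a > 0" "\<phi> 0 = x0" "smooth_on {-a<..<a} \<phi>" "\<And>t. \<phi> t \<in> D"
    "\<And>t. t \<in> {-a<..<a} \<Longrightarrow> (\<phi> has_vector_derivative F (\<phi> t)) (at t)"
proof -
  have "C_k_on (Suc 0) D F" using assms(3) unfolding smooth_on_def by blast
  then obtain r K where rK: "r > 0" "K \<ge> 0" "cball x0 r \<subseteq> D"
    "\<And>x y. x \<in> cball x0 r \<Longrightarrow> y \<in> cball x0 r \<Longrightarrow> norm (F x - F y) \<le> K * norm (x - y)"
    using C1_imp_lipschitz_near[OF assms(1,2)] by metis
  obtain a \<phi> where sol: "a > 0" "\<phi> 0 = x0" "\<And>t. \<phi> t \<in> cball x0 r"
    "\<And>t. t \<in> {-a<..<a} \<Longrightarrow> (\<phi> has_vector_derivative F (\<phi> t)) (at t)"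
    using picard_lindelof_local[OF rK(1,2,4)] by metis
  have inD: "\<phi> t \<in> D" for t using sol(3) rK(3) by blast
  show thesis
    by (rule that[OF sol(1,2) smooth_on_ode_solution[OF _ assms(1,3) inD sol(4)] inD sol(4)]) auto
qed

section \<open>Bilinear forms given by matrices\<close>

lemma form_eq_sum:
  fixes M :: "real^'n::finite^'n"
  shows "v \<bullet> (M *v w) = (\<Sum>i\<in>UNIV. \<Sum>j\<in>UNIV. M $ i $ j * v $ i * w $ j)"
  by (simp add: inner_vec_def matrix_vector_mult_def sum_distrib_left mult_ac)

lemma form_sym:
  fixes M :: "real^'n::finite^'n"
  assumes "transpose M = M"
  shows "v \<bullet> (M *v w) = w \<bullet> (M *v v)"
  by (metis assms dot_lmul_matrix inner_commute vector_transpose_matrix)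

lemma bounded_bilinear_matrix_vector_mult:
  "bounded_bilinear ((*v) :: real^'n::finite^'m::finite \<Rightarrow> real^'n \<Rightarrow> real^'m)"
  unfolding bilinear_conv_bounded_bilinear[symmetric] bilinear_def
  by (auto intro!: linearI simp: matrix_vector_mult_add_rdistrib matrix_vector_right_distrib
      matrix_vector_mult_scaleR scaleR_matrix_vector_assoc)

lemma has_derivative_form:
  fixes M :: "'a::real_normed_vector \<Rightarrow> real^'n::finite^'n"
  assumes "(v has_derivative v') (at x)" "(M has_derivative M') (at x)" "(w has_derivative w') (at x)"
  shows "((\<lambda>x. v x \<bullet> (M x *v w x)) has_derivative
    (\<lambda>h. v' h \<bullet> (M x *v w x) + v x \<bullet> (M' h *v w x) + v x \<bullet> (M x *v w' h))) (at x)"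
  using bounded_bilinear.FDERIV[OF bounded_bilinear_inner assms(1)
      bounded_bilinear.FDERIV[OF bounded_bilinear_matrix_vector_mult assms(2,3)]]
  by (simp add: inner_add_right add_ac)

lemma pderiv_at_matrix_entry:
  fixes G :: "real^'n::finite \<Rightarrow> real^'m::finite^'k::finite"
  assumes "G differentiable (at x)"
  shows "pderiv_at i (\<lambda>y. G y $ p $ q) x = frechet_derivative G (at x) (axis i 1) $ p $ q"
  unfolding pderiv_at_def
  by (rule frechet_derivative_bounded_linear_comp[OF _ assms])
    (rule bounded_linear_compose[OF bounded_linear_vec_nth bounded_linear_vec_nth])

lemma frechet_derivative_matrix_entry:
  fixes G :: "real^'n::finite \<Rightarrow> real^'m::finite^'k::finite"
  assumes "G differentiable (at x)"
  shows "frechet_derivative G (at x) v $ p $ q = (\<Sum>i\<in>UNIV. v $ i * pderiv_at i (\<lambda>y. G y $ p $ q) x)"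
proof -
  let ?D = "frechet_derivative G (at x)"
  have "linear ?D"
    using assms by (rule linear_frechet_derivative)
  have "?D v = ?D (\<Sum>i\<in>UNIV. v $ i *\<^sub>R axis i 1)"
    using basis_expansion[of v] by (simp add: scalar_mult_eq_scaleR)
  also have "\<dots> = (\<Sum>i\<in>UNIV. v $ i *\<^sub>R ?D (axis i 1))"
    using \<open>linear ?D\<close> by (simp add: linear_sum linear_scale)
  finally show ?thesis
    by (simp add: pderiv_at_matrix_entry[OF assms])
qed

section \<open>The geodesic equation as an Euler--Lagrange equation\<close>

text \<open>The Euler--Lagrange equation of the energy \<open>v \<bullet> (G x *v v) / 2\<close> at position \<open>x\<close>, velocity \<open>v\<close>
  and acceleration \<open>a\<close>, tested against all directions \<open>w\<close>. Unlike the Christoffel symbols it only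
  involves forms that can be pulled back, so its behaviour under a change of chart is a short
  computation.\<close>

definition euler_lagrange ::
    "(real^'n \<Rightarrow> real^'n^'n) \<Rightarrow> real^'n::finite \<Rightarrow> real^'n \<Rightarrow> real^'n \<Rightarrow> bool" where
  "euler_lagrange G x v a \<longleftrightarrow> (\<forall>w. w \<bullet> (G x *v a) + w \<bullet> (frechet_derivative G (at x) v *v v)
     - (1/2) * (v \<bullet> (frechet_derivative G (at x) w *v v)) = 0)"

text \<open>Lowering the index of the Christoffel symbols leaves only first derivatives of the metric, and
  contraction with \<open>v\<close> twice merges two of the three terms.\<close>

lemma christoffel_form:
  fixes G :: "real^'n::finite \<Rightarrow> real^'n^'n"
  assumes "open S" "x \<in> S" "G differentiable (at x)" "\<And>y. y \<in> S \<Longrightarrow> transpose (G y) = G y"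
    and inv: "invertible (G x)"
  shows "w \<bullet> (G x *v (\<chi> k. \<Sum>i\<in>UNIV. \<Sum>j\<in>UNIV. christoffel G k i j x * v $ i * v $ j)) =
    w \<bullet> (frechet_derivative G (at x) v *v v) - (1/2) * (v \<bullet> (frechet_derivative G (at x) w *v v))"
proof -
  define P where "P i p q = pderiv_at i (\<lambda>y. G y $ p $ q) x" for i p q
  have Psym: "P i p q = P i q p" for i p q
    unfolding P_def using assms(1,2,4) by (rule pderiv_at_metric_sym)
  let ?c = "\<chi> k. \<Sum>i\<in>UNIV. \<Sum>j\<in>UNIV. christoffel G k i j x * v $ i * v $ j"
  let ?T = "\<lambda>f. \<Sum>m\<in>UNIV. \<Sum>i\<in>UNIV. \<Sum>j\<in>UNIV. f m i j * w $ m * v $ i * v $ j"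
  have comp: "(G x *v ?c) $ m = (\<Sum>i\<in>UNIV. \<Sum>j\<in>UNIV.
      (1/2) * (P i j m + P j i m - P m i j) * v $ i * v $ j)" for m
  proof -
    have "(G x *v ?c) $ m = (\<Sum>k\<in>UNIV. \<Sum>i\<in>UNIV. \<Sum>j\<in>UNIV.
        G x $ m $ k * christoffel G k i j x * v $ i * v $ j)"
      by (simp add: matrix_vector_mult_def sum_distrib_left mult.assoc)
    also have "\<dots> = (\<Sum>i\<in>UNIV. \<Sum>k\<in>UNIV. \<Sum>j\<in>UNIV.
        G x $ m $ k * christoffel G k i j x * v $ i * v $ j)"
      by (rule sum.swap)
    also have "\<dots> = (\<Sum>i\<in>UNIV. \<Sum>j\<in>UNIV. \<Sum>k\<in>UNIV.
        G x $ m $ k * christoffel G k i j x * v $ i * v $ j)"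
      by (intro sum.cong refl sum.swap)
    also have "\<dots> = (\<Sum>i\<in>UNIV. \<Sum>j\<in>UNIV.
        (\<Sum>k\<in>UNIV. G x $ m $ k * christoffel G k i j x) * v $ i * v $ j)"
      by (simp add: sum_distrib_right)
    finally show ?thesis unfolding christoffel_lower[of G x, OF inv] P_def .
  qed
  have "w \<bullet> (G x *v ?c) = ?T (\<lambda>m i j. (1/2) * (P i j m + P j i m - P m i j))"
    unfolding inner_vec_def comp by (simp add: sum_distrib_left mult_ac)
  also have "\<dots> = (1/2) * (?T (\<lambda>m i j. P i j m) + ?T (\<lambda>m i j. P j i m) - ?T (\<lambda>m i j. P m i j))"
    by (simp add: sum_distrib_left sum.distrib[symmetric] sum_subtractf[symmetric] algebra_simps)
  also have "?T (\<lambda>m i j. P j i m) = ?T (\<lambda>m i j. P i j m)"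
    by (subst sum.swap) (simp add: mult_ac)
  also have "?T (\<lambda>m i j. P i j m) = w \<bullet> (frechet_derivative G (at x) v *v v)"
  proof -
    have "w \<bullet> (frechet_derivative G (at x) v *v v) =
        (\<Sum>m\<in>UNIV. \<Sum>j\<in>UNIV. \<Sum>i\<in>UNIV. P i m j * w $ m * v $ i * v $ j)"
      unfolding form_eq_sum frechet_derivative_matrix_entry[OF assms(3)] P_def[symmetric]
      by (simp add: sum_distrib_left sum_distrib_right mult_ac)
    also have "\<dots> = (\<Sum>m\<in>UNIV. \<Sum>i\<in>UNIV. \<Sum>j\<in>UNIV. P i m j * w $ m * v $ i * v $ j)"
      by (intro sum.cong refl sum.swap)
    finally show ?thesis using Psym by simp
  qed
  also have "?T (\<lambda>m i j. P m i j) = v \<bullet> (frechet_derivative G (at x) w *v v)"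
  proof -
    have "v \<bullet> (frechet_derivative G (at x) w *v v) =
        (\<Sum>i\<in>UNIV. \<Sum>j\<in>UNIV. \<Sum>m\<in>UNIV. P m i j * w $ m * v $ i * v $ j)"
      unfolding form_eq_sum frechet_derivative_matrix_entry[OF assms(3)] P_def[symmetric]
      by (simp add: sum_distrib_left sum_distrib_right mult_ac)
    also have "\<dots> = (\<Sum>i\<in>UNIV. \<Sum>m\<in>UNIV. \<Sum>j\<in>UNIV. P m i j * w $ m * v $ i * v $ j)"
      by (intro sum.cong refl sum.swap)
    also have "\<dots> = ?T (\<lambda>m i j. P m i j)" by (rule sum.swap)
    finally show ?thesis by simp
  qed
  finally show ?thesis by (simp add: field_simps)
qed

lemma geodesic_equation_iff_euler_lagrange:
  fixes G :: "real^'n::finite \<Rightarrow> real^'n^'n"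
  assumes "open S" "x \<in> S" "G differentiable (at x)" "\<And>y. y \<in> S \<Longrightarrow> transpose (G y) = G y"
    and inv: "invertible (G x)"
  shows "(\<forall>k. a $ k + (\<Sum>i\<in>UNIV. \<Sum>j\<in>UNIV. christoffel G k i j x * v $ i * v $ j) = 0) \<longleftrightarrow>
    euler_lagrange G x v a"
proof -
  let ?c = "\<chi> k. \<Sum>i\<in>UNIV. \<Sum>j\<in>UNIV. christoffel G k i j x * v $ i * v $ j"
  have "(\<forall>k. a $ k + (\<Sum>i\<in>UNIV. \<Sum>j\<in>UNIV. christoffel G k i j x * v $ i * v $ j) = 0) \<longleftrightarrow>
      a + ?c = 0"
    by (simp add: vec_eq_iff)
  also have "\<dots> \<longleftrightarrow> G x *v (a + ?c) = 0"
  proof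
    assume "G x *v (a + ?c) = 0"
    then have "matrix_inv (G x) *v (G x *v (a + ?c)) = 0" by (simp only: matrix_vector_mult_0_right)
    then show "a + ?c = 0" by (simp add: matrix_vector_mul_assoc matrix_inv_left[OF inv])
  qed simp
  also have "\<dots> \<longleftrightarrow> (\<forall>w. w \<bullet> (G x *v (a + ?c)) = 0)"
    by (auto dest!: spec[of _ "G x *v (a + ?c)"])
  also have "\<dots> \<longleftrightarrow> euler_lagrange G x v a"
  proof -
    have "w \<bullet> (G x *v (a + ?c)) = w \<bullet> (G x *v a) + w \<bullet> (frechet_derivative G (at x) v *v v)
       - (1/2) * (v \<bullet> (frechet_derivative G (at x) w *v v))" for w
      using christoffel_form[OF assms, of w v]
      by (simp add: matrix_vector_right_distrib inner_add_right)
    then show ?thesis unfolding euler_lagrange_def by simp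
  qed
  finally show ?thesis .
qed

text \<open>The metric in one chart as the pull-back under a change of chart \<open>\<phi>\<close>: differentiating it gives,
  besides the derivative of the other metric, two terms with second derivatives of \<open>\<phi>\<close>.\<close>

lemma pullback_derivative:
  fixes G H :: "real^'n::finite \<Rightarrow> real^'n^'n" and \<phi> :: "real^'n \<Rightarrow> real^'n"
  defines "D \<equiv> \<lambda>y. frechet_derivative \<phi> (at y)"
    and "B \<equiv> \<lambda>y v w. frechet_derivative (\<lambda>x. frechet_derivative \<phi> (at x) v) (at y) w"
  assumes W: "open W" "x \<in> W" and phi: "smooth_on W \<phi>"
    and G: "G differentiable (at x)" and H: "H differentiable (at (\<phi> x))"
    and pull: "\<And>y v w. y \<in> W \<Longrightarrow> v \<bullet> (G y *v w) = D y v \<bullet> (H (\<phi> y) *v D y w)"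
  shows "v \<bullet> (frechet_derivative G (at x) h *v w) =
    B x v h \<bullet> (H (\<phi> x) *v D x w) + D x v \<bullet> (frechet_derivative H (at (\<phi> x)) (D x h) *v D x w)
      + D x v \<bullet> (H (\<phi> x) *v B x w h)"
proof -
  have Dd: "((\<lambda>y. D y v) has_derivative B x v) (at x)" for v
    unfolding D_def B_def
    by (rule smooth_on_has_derivative[OF smooth_on_frechet_derivative[OF phi] W(2)])
  have "((\<lambda>y. H (\<phi> y)) has_derivative (\<lambda>h. frechet_derivative H (at (\<phi> x)) (D x h))) (at x)"
    unfolding D_def
    by (rule has_derivative_compose[OF smooth_on_has_derivative[OF phi W(2)]])
      (use H frechet_derivative_works in blast)
  from has_derivative_form[OF Dd[of v] this Dd[of w]]
  have "((\<lambda>y. v \<bullet> (G y *v w)) has_derivative (\<lambda>h. B x v h \<bullet> (H (\<phi> x) *v D x w)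
      + D x v \<bullet> (frechet_derivative H (at (\<phi> x)) (D x h) *v D x w)
      + D x v \<bullet> (H (\<phi> x) *v B x w h))) (at x)"
    by (rule has_derivative_transform_within_open[OF _ W]) (simp add: pull)
  then have "(\<lambda>h. v \<bullet> (frechet_derivative G (at x) h *v w)) =
      (\<lambda>h. B x v h \<bullet> (H (\<phi> x) *v D x w)
      + D x v \<bullet> (frechet_derivative H (at (\<phi> x)) (D x h) *v D x w)
      + D x v \<bullet> (H (\<phi> x) *v B x w h))"
    by (rule has_derivative_unique[rotated])
      (use has_derivative_form[OF has_derivative_const[of v] G[unfolded frechet_derivative_works]
          has_derivative_const[of w]] in simp)
  then show ?thesis by (rule fun_cong)
qed

text \<open>Write \<open>B\<close> for the second derivative of \<open>\<phi>\<close>. The derivative of the metric along the velocity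
  contributes \<open>B x w v\<close>; the derivative along the test direction contributes \<open>B x v w\<close> twice, with the
  factor \<open>- 1/2\<close>. These cancel because \<open>B x\<close> is symmetric. What is left is \<open>B x v v\<close>, the term that the
  acceleration picks up under \<open>\<phi>\<close>. Every direction in the other chart is an image of a test
  direction \<open>w\<close>, since the derivative of \<open>\<phi>\<close> is onto.\<close>

lemma euler_lagrange_chart_change:
  fixes G H :: "real^'n::finite \<Rightarrow> real^'n^'n" and \<phi> :: "real^'n \<Rightarrow> real^'n"
  defines "D \<equiv> \<lambda>y. frechet_derivative \<phi> (at y)"
    and "B \<equiv> \<lambda>y v w. frechet_derivative (\<lambda>x. frechet_derivative \<phi> (at x) v) (at y) w"
  assumes W: "open W" "x \<in> W" and phi: "smooth_on W \<phi>"
    and G: "G differentiable (at x)" and H: "H differentiable (at (\<phi> x))"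
    and pull: "\<And>y v w. y \<in> W \<Longrightarrow> v \<bullet> (G y *v w) = D y v \<bullet> (H (\<phi> y) *v D y w)"
    and sym: "transpose (H (\<phi> x)) = H (\<phi> x)" and surj: "surj (D x)"
    and EL: "euler_lagrange G x v a"
  shows "euler_lagrange H (\<phi> x) (D x v) (B x v v + D x a)"
  unfolding euler_lagrange_def
proof
  fix w'
  obtain w where w: "w' = D x w" using surj by (meson surjD)
  have "C_k_on (Suc (Suc 0)) W \<phi>" using phi unfolding smooth_on_def by blast
  then have Bsym: "B x p q = B x q p" for p q
    unfolding B_def by (rule second_derivative_symmetric[OF W])
  have deriv: "p \<bullet> (frechet_derivative G (at x) h *v q) =
    B x p h \<bullet> (H (\<phi> x) *v D x q) + D x p \<bullet> (frechet_derivative H (at (\<phi> x)) (D x h) *v D x q)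
      + D x p \<bullet> (H (\<phi> x) *v B x q h)" for p q h
    unfolding B_def D_def
    by (rule pullback_derivative[OF W phi G H pull[unfolded D_def]])
  have "w \<bullet> (G x *v a) + w \<bullet> (frechet_derivative G (at x) v *v v)
     - (1/2) * (v \<bullet> (frechet_derivative G (at x) w *v v)) = 0"
    using EL unfolding euler_lagrange_def by blast
  then show "w' \<bullet> (H (\<phi> x) *v (B x v v + D x a))
      + w' \<bullet> (frechet_derivative H (at (\<phi> x)) (D x v) *v D x v)
      - (1/2) * (D x v \<bullet> (frechet_derivative H (at (\<phi> x)) w' *v D x v)) = 0"
    unfolding deriv pull[OF W(2)] w matrix_vector_right_distrib inner_add_right
    using Bsym[of v w] form_sym[OF sym, of "D x v" "B x w v"] by simp
qed

section \<open>Curves in coordinates\<close>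

lemma has_vector_derivative_velocity:
  assumes "smooth_on J u" "t \<in> J"
  shows "(u has_vector_derivative velocity u t) (at t)"
  using smooth_on_has_derivative[OF assms] unfolding velocity_def
  by (meson differentiable_def vector_derivative_works)

lemma smooth_on_velocity:
  assumes "open J" "smooth_on J u"
  shows "smooth_on J (velocity u)"
proof -
  have "frechet_derivative u (at t) 1 = velocity u t" if "t \<in> J" for t
    using frechet_derivative_at[OF has_vector_derivative_velocity[OF assms(2) that,
          unfolded has_vector_derivative_def], symmetric] by simp
  then show ?thesis
    using smooth_on_cong[OF assms(1), of "\<lambda>t. frechet_derivative u (at t) 1" "velocity u"]
      smooth_on_frechet_derivative[OF assms(2), of 1] by simp
qed

lemma velocity_eqI: "(u has_vector_derivative v) (at t) \<Longrightarrow> velocity u t = v"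
  unfolding velocity_def by (rule vector_derivative_at)

lemma velocity_open_cong:
  assumes "open J" "t \<in> J" "\<And>s. s \<in> J \<Longrightarrow> u s = v s"
  shows "velocity u t = velocity v t"
proof -
  have "(u has_vector_derivative d) (at t) \<longleftrightarrow> (v has_vector_derivative d) (at t)" for d
    unfolding has_vector_derivative_def by (rule has_derivative_open_cong[OF assms])
  then show ?thesis by (simp add: velocity_def vector_derivative_def)
qed

lemma velocity_compose:
  fixes \<phi> :: "real^'n::finite \<Rightarrow> real^'m::finite"
  assumes "open J" "smooth_on J u" "t \<in> J" and "smooth_on W \<phi>" "u ` J \<subseteq> W"
  shows "velocity (\<lambda>t. \<phi> (u t)) t = frechet_derivative \<phi> (at (u t)) (velocity u t)"
proof (rule velocity_eqI)
  have "(\<phi> has_derivative frechet_derivative \<phi> (at (u t))) (at (u t))"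
    using assms by (intro smooth_on_has_derivative) auto
  from vector_derivative_diff_chain_within[OF has_vector_derivative_velocity[OF assms(2,3)]
      has_derivative_at_withinI[OF this]]
  show "((\<lambda>t. \<phi> (u t)) has_vector_derivative frechet_derivative \<phi> (at (u t)) (velocity u t)) (at t)"
    by (simp add: o_def)
qed

text \<open>The velocity of the image curve is a derivative of \<open>\<phi>\<close> in a direction that moves along the curve.
  It is expanded in a basis before it is differentiated once more.\<close>

lemma acceleration_compose:
  fixes \<phi> :: "real^'n::finite \<Rightarrow> real^'m::finite"
  assumes J: "open J" "t \<in> J" and u: "smooth_on J u" and W: "open W" "smooth_on W \<phi>" "u ` J \<subseteq> W"
  shows "velocity (velocity (\<lambda>t. \<phi> (u t))) t =
    frechet_derivative (\<lambda>x. frechet_derivative \<phi> (at x) (velocity u t)) (at (u t)) (velocity u t)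
      + frechet_derivative \<phi> (at (u t)) (velocity (velocity u) t)"
proof -
  let ?D = "\<lambda>x. frechet_derivative \<phi> (at x)" and ?v = "velocity u"
  have v: "smooth_on J ?v" by (rule smooth_on_velocity[OF J(1) u])
  have lin: "bounded_linear (?D x)" if "x \<in> W" for x
    using smooth_on_has_derivative[OF W(2) that] by (rule has_derivative_bounded_linear)
  have ut: "u t \<in> W" using W J by auto
  have D: "((\<lambda>s. ?D (u s) w) has_vector_derivative
      frechet_derivative (\<lambda>x. ?D x w) (at (u t)) (?v t)) (at t)" for w
    using vector_derivative_diff_chain_within[OF has_vector_derivative_velocity[OF u J(2)]
        has_derivative_at_withinI[OF smooth_on_has_derivative[OF
            smooth_on_frechet_derivative[OF W(2)] ut]]]
    by (simp add: o_def)
  let ?E = "\<lambda>s. \<Sum>b\<in>Basis. (?v s \<bullet> b) *\<^sub>R ?D (u s) b"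
  have E: "(?E has_vector_derivative (\<Sum>b\<in>Basis.
      (?v t \<bullet> b) *\<^sub>R frechet_derivative (\<lambda>x. ?D x b) (at (u t)) (?v t) + (velocity ?v t \<bullet> b) *\<^sub>R ?D (u t) b))
      (at t)"
  proof (intro has_vector_derivative_sum)
    fix b :: "real^'n"
    have "((\<lambda>s. ?v s \<bullet> b) has_real_derivative velocity ?v t \<bullet> b) (at t)"
      using bounded_linear.has_vector_derivative[OF bounded_linear_inner_left
          has_vector_derivative_velocity[OF v J(2)]]
      by (simp add: has_real_derivative_iff_has_vector_derivative)
    from has_vector_derivative_scaleR[OF this D]
    show "((\<lambda>s. (?v s \<bullet> b) *\<^sub>R ?D (u s) b) has_vector_derivative
      (?v t \<bullet> b) *\<^sub>R frechet_derivative (\<lambda>x. ?D x b) (at (u t)) (?v t)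
        + (velocity ?v t \<bullet> b) *\<^sub>R ?D (u t) b) (at t)" .
  qed
  \<comment> \<open>the second derivative is also linear in the direction that is differentiated first\<close>
  have second: "frechet_derivative (\<lambda>x. ?D x w) (at (u t)) h =
      (\<Sum>b\<in>Basis. (w \<bullet> b) *\<^sub>R frechet_derivative (\<lambda>x. ?D x b) (at (u t)) h)" for w h
  proof -
    have "((\<lambda>x. \<Sum>b\<in>Basis. (w \<bullet> b) *\<^sub>R ?D x b) has_derivative
        (\<lambda>h. \<Sum>b\<in>Basis. (w \<bullet> b) *\<^sub>R frechet_derivative (\<lambda>x. ?D x b) (at (u t)) h)) (at (u t))"
      using smooth_on_has_derivative[OF smooth_on_frechet_derivative[OF W(2)] ut]
      by (intro has_derivative_sum has_derivative_scaleR_right)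
    then have "((\<lambda>x. ?D x w) has_derivative
        (\<lambda>h. \<Sum>b\<in>Basis. (w \<bullet> b) *\<^sub>R frechet_derivative (\<lambda>x. ?D x b) (at (u t)) h)) (at (u t))"
    proof (rule has_derivative_transform_within_open[OF _ W(1) ut])
      fix x assume "x \<in> W"
      from linear_expand_Basis[OF lin[OF this], of w]
      show "(\<Sum>b\<in>Basis. (w \<bullet> b) *\<^sub>R ?D x b) = ?D x w" by (rule sym)
    qed
    from fun_cong[OF frechet_derivative_at[OF this], of h] show ?thesis by (rule sym)
  qed
  have "velocity (\<lambda>t. \<phi> (u t)) s = ?E s" if "s \<in> J" for s
  proof -
    have "u s \<in> W" using W(3) that by auto
    from linear_expand_Basis[OF lin[OF this], of "?v s"] show ?thesis
      unfolding velocity_compose[OF J(1) u that W(2,3)] .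
  qed
  then have "velocity (velocity (\<lambda>t. \<phi> (u t))) t = velocity ?E t"
    by (rule velocity_open_cong[OF J])
  also have "\<dots> = (\<Sum>b\<in>Basis.
      (?v t \<bullet> b) *\<^sub>R frechet_derivative (\<lambda>x. ?D x b) (at (u t)) (?v t) + (velocity ?v t \<bullet> b) *\<^sub>R ?D (u t) b)"
    by (rule velocity_eqI[OF E])
  also have "\<dots> = frechet_derivative (\<lambda>x. ?D x (?v t)) (at (u t)) (?v t) + ?D (u t) (velocity ?v t)"
    unfolding second[of "?v t" "?v t"] linear_expand_Basis[OF lin[OF ut], of "velocity ?v t"]
      sum.distrib ..
  finally show ?thesis .
qed

section \<open>Null geodesics in coordinates\<close>

text \<open>Testing the Euler--Lagrange equation with the velocity itself shows that the energy is a
  constant of motion.\<close>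

lemma euler_lagrange_energy_derivative:
  fixes G :: "real^'n::finite \<Rightarrow> real^'n^'n"
  assumes J: "open J" "t \<in> J" and u: "smooth_on J u"
    and G: "G differentiable (at (u t))" and sym: "transpose (G (u t)) = G (u t)"
    and EL: "euler_lagrange G (u t) (velocity u t) (velocity (velocity u) t)"
  shows "((\<lambda>s. velocity u s \<bullet> (G (u s) *v velocity u s)) has_real_derivative 0) (at t)"
proof -
  let ?v = "velocity u t" and ?a = "velocity (velocity u) t" and ?D = "frechet_derivative G (at (u t))"
  have v: "(velocity u has_derivative (\<lambda>h. h *\<^sub>R ?a)) (at t)"
    using has_vector_derivative_velocity[OF smooth_on_velocity[OF J(1) u] J(2)]
    unfolding has_vector_derivative_def .
  have "((\<lambda>s. G (u s)) has_derivative (\<lambda>h. ?D (h *\<^sub>R ?v))) (at t)"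
    by (rule has_derivative_compose[OF has_vector_derivative_velocity[OF u J(2),
            unfolded has_vector_derivative_def]])
      (use G frechet_derivative_works in blast)
  from has_derivative_form[OF v this v]
  have "((\<lambda>s. velocity u s \<bullet> (G (u s) *v velocity u s)) has_derivative
      (\<lambda>h. (h *\<^sub>R ?a) \<bullet> (G (u t) *v ?v) + ?v \<bullet> (?D (h *\<^sub>R ?v) *v ?v)
        + ?v \<bullet> (G (u t) *v (h *\<^sub>R ?a)))) (at t)" .
  moreover have "(h *\<^sub>R ?a) \<bullet> (G (u t) *v ?v) + ?v \<bullet> (?D (h *\<^sub>R ?v) *v ?v)
        + ?v \<bullet> (G (u t) *v (h *\<^sub>R ?a)) = 0 * h" for h
  proof -
    have "?v \<bullet> (G (u t) *v ?a) + ?v \<bullet> (?D ?v *v ?v) - (1/2) * (?v \<bullet> (?D ?v *v ?v)) = 0"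
      using EL unfolding euler_lagrange_def by blast
    moreover have "?a \<bullet> (G (u t) *v ?v) = ?v \<bullet> (G (u t) *v ?a)"
      by (rule form_sym[OF sym])
    moreover have "?D (h *\<^sub>R ?v) = h *\<^sub>R ?D ?v"
      using linear_frechet_derivative[OF G] by (rule linear_scale)
    ultimately have "(h *\<^sub>R ?a) \<bullet> (G (u t) *v ?v) + ?v \<bullet> (?D (h *\<^sub>R ?v) *v ?v)
        + ?v \<bullet> (G (u t) *v (h *\<^sub>R ?a)) = h * (2 * (?v \<bullet> (G (u t) *v ?a)) + ?v \<bullet> (?D ?v *v ?v))"
      by (simp add: matrix_vector_mult_scaleR scaleR_matrix_vector_assoc[symmetric] algebra_simps)
    also have "\<dots> = 0" using \<open>_ - (1/2) * _ = 0\<close> by simp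
    finally show ?thesis by simp
  qed
  ultimately show ?thesis unfolding has_field_derivative_def by (simp only:)
qed

text \<open>The geodesic equation is a first-order system for position and velocity. A solution starts with
  a null velocity and keeps it, because the energy is constant.\<close>

theorem null_geodesic_in_coordinates:
  fixes G :: "real^'n::finite \<Rightarrow> real^'n^'n"
  assumes S: "open S" and G: "smooth_on S G"
    and sym: "\<And>x. x \<in> S \<Longrightarrow> transpose (G x) = G x" and inv: "\<And>x. x \<in> S \<Longrightarrow> invertible (G x)"
    and x0: "x0 \<in> S" and null: "v0 \<bullet> (G x0 *v v0) = 0"
  obtains a u where "a > 0" "smooth_on {-a<..<a} u" "u 0 = x0" "velocity u 0 = v0"
    "\<And>t. u t \<in> S"
    "\<And>t. t \<in> {-a<..<a} \<Longrightarrow> euler_lagrange G (u t) (velocity u t) (velocity (velocity u) t)"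
    "\<And>t. t \<in> {-a<..<a} \<Longrightarrow> velocity u t \<bullet> (G (u t) *v velocity u t) = 0"
proof -
  let ?F = "\<lambda>z :: (real^'n) \<times> (real^'n). (snd z, \<chi> k.
    - (\<Sum>i\<in>UNIV. \<Sum>j\<in>UNIV. christoffel G k i j (fst z) * snd z $ i * snd z $ j))"
  let ?D = "S \<times> (UNIV :: (real^'n) set)"
  have D: "open ?D" using S by (intro open_Times) auto
  have F: "smooth_on ?D ?F"
    unfolding smooth_on_def
  proof
    fix m
    have snd: "C_k_on m ?D snd" by (rule C_k_on_linear[OF D bounded_linear_snd])
    have "smooth_on ?D (\<lambda>z. christoffel G k i j (fst z))" for k i j
      by (rule smooth_on_compose[OF D S _ smooth_on_christoffel[OF S G inv]])
        (auto simp: smooth_on_def intro!: C_k_on_linear D bounded_linear_fst)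
    then have "C_k_on m ?D (\<lambda>z. christoffel G k i j (fst z))" for k i j
      unfolding smooth_on_def by blast
    then show "C_k_on m ?D ?F"
      by (intro C_k_on_Pair snd C_k_on_vec_lambda C_k_on_minus C_k_on_sum C_k_on_mult
          C_k_on_vec_nth D)
  qed
  obtain a \<phi> where a: "a > 0" and phi: "\<phi> 0 = (x0, v0)" "smooth_on {-a<..<a} \<phi>" "\<And>t. \<phi> t \<in> ?D"
    "\<And>t. t \<in> {-a<..<a} \<Longrightarrow> (\<phi> has_vector_derivative ?F (\<phi> t)) (at t)"
    using smooth_ode_local_solution[OF D _ F, of "(x0, v0)"] x0 by blast
  let ?I = "{-a<..<a}"
  have I: "open ?I" by simp
  define u where "u t = fst (\<phi> t)" for t
  have u: "smooth_on ?I u"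
    using phi(2) C_k_on_bounded_linear_comp[OF I bounded_linear_fst]
    unfolding smooth_on_def u_def by blast
  have uS: "u t \<in> S" for t using phi(3)[of t] by (auto simp: u_def)
  have vel: "velocity u t = snd (\<phi> t)" if "t \<in> ?I" for t
    using bounded_linear.has_vector_derivative[OF bounded_linear_fst phi(4)[OF that]]
    unfolding u_def by (intro velocity_eqI) simp
  have acc: "velocity (velocity u) t = snd (?F (\<phi> t))" if "t \<in> ?I" for t
  proof -
    have "velocity (velocity u) t = velocity (\<lambda>t. snd (\<phi> t)) t"
      by (rule velocity_open_cong[OF I that vel])
    also have "\<dots> = snd (?F (\<phi> t))"
      by (intro velocity_eqI bounded_linear.has_vector_derivative[OF bounded_linear_snd phi(4)] that)
    finally show ?thesis .
  qed
  have Gd: "G differentiable (at (u t))" for t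
    using smooth_on_has_derivative[OF G uS] unfolding differentiable_def by blast
  have EL: "euler_lagrange G (u t) (velocity u t) (velocity (velocity u) t)" if "t \<in> ?I" for t
  proof -
    have "\<forall>k. velocity (velocity u) t $ k + (\<Sum>i\<in>UNIV. \<Sum>j\<in>UNIV. christoffel G k i j (u t) *
        velocity u t $ i * velocity u t $ j) = 0"
      by (simp add: acc[OF that] vel[OF that] u_def)
    then show ?thesis
      using geodesic_equation_iff_euler_lagrange[OF S uS Gd sym inv[OF uS]] by blast
  qed
  have "velocity u t \<bullet> (G (u t) *v velocity u t) = velocity u 0 \<bullet> (G (u 0) *v velocity u 0)"
    if "t \<in> ?I" for t
  proof (rule DERIV_zero_connected_constant[where S = ?I and K = "{}"])
    show "\<forall>t\<in>?I - {}. DERIV (\<lambda>s. velocity u s \<bullet> (G (u s) *v velocity u s)) t :> 0"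
      using euler_lagrange_energy_derivative[OF I _ u Gd sym[OF uS] EL] by blast
    show "continuous_on ?I (\<lambda>s. velocity u s \<bullet> (G (u s) *v velocity u s))"
      using euler_lagrange_energy_derivative[OF I _ u Gd sym[OF uS] EL]
      by (intro continuous_at_imp_continuous_on ballI) (blast intro: DERIV_isCont)
  qed (use a that in auto)
  moreover have init: "u 0 = x0" "velocity u 0 = v0"
    using a vel[of 0] phi(1) by (auto simp: u_def)
  ultimately have u_null: "velocity u t \<bullet> (G (u t) *v velocity u t) = 0" if "t \<in> ?I" for t
    using that null by simp
  show thesis
    by (rule that[OF a u init uS EL u_null])
qed

section \<open>Third derivative along null geodesics\<close>

lemma has_real_derivative_along_curve:
  fixes f :: "real^'n::finite \<Rightarrow> real"
  assumes "smooth_on S f" "u t \<in> S" "(u has_vector_derivative v) (at t)"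
  shows "((\<lambda>s. f (u s)) has_real_derivative (\<Sum>k\<in>UNIV. pderiv_at k f (u t) * v $ k)) (at t)"
proof -
  let ?D = "frechet_derivative f (at (u t))"
  have f: "(f has_derivative ?D) (at (u t))"
    by (rule smooth_on_has_derivative[OF assms(1,2)])
  have "((\<lambda>s. f (u s)) has_vector_derivative ?D v) (at t)"
    using vector_derivative_diff_chain_within[OF assms(3) has_derivative_at_withinI[OF f]]
    by (simp add: o_def)
  moreover have "?D v = (\<Sum>k\<in>UNIV. pderiv_at k f (u t) * v $ k)"
  proof -
    have "linear ?D" using f by (rule has_derivative_linear)
    have "?D v = ?D (\<Sum>i\<in>UNIV. v $ i *\<^sub>R axis i 1)"
      using basis_expansion[of v] by (simp add: scalar_mult_eq_scaleR)
    also have "\<dots> = (\<Sum>i\<in>UNIV. v $ i *\<^sub>R ?D (axis i 1))"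
      using \<open>linear ?D\<close> by (simp add: linear_sum linear_scale)
    finally show ?thesis by (simp add: pderiv_at_def mult.commute)
  qed
  ultimately show ?thesis by (simp add: has_real_derivative_iff_has_vector_derivative)
qed

text \<open>Along a geodesic the covariant derivative of a tensor, contracted with the velocity, is the
  ordinary derivative of the contracted tensor: the Christoffel terms are the acceleration. This
  is needed for the differential of a function and for its second covariant derivative.\<close>

lemma covector_derivative_along_geodesic:
  fixes w :: "'n::finite \<Rightarrow> real^'n \<Rightarrow> real"
  assumes w: "\<And>i. smooth_on S (w i)" and ut: "u t \<in> S"
    and u: "(u has_vector_derivative v t) (at t)" and v: "(v has_vector_derivative a) (at t)"
    and geo: "\<And>k. a $ k = - (\<Sum>i\<in>UNIV. \<Sum>j\<in>UNIV. christoffel G k i j (u t) * v t $ i * v t $ j)"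
  shows "((\<lambda>s. \<Sum>i\<in>UNIV. w i (u s) * v s $ i) has_real_derivative
    (\<Sum>j\<in>UNIV. \<Sum>i\<in>UNIV. nabla1 G w j i (u t) * v t $ j * v t $ i)) (at t)"
proof -
  have vi: "((\<lambda>s. v s $ i) has_real_derivative a $ i) (at t)" for i
    using bounded_linear.has_vector_derivative[OF bounded_linear_vec_nth v]
    by (simp add: has_real_derivative_iff_has_vector_derivative)
  have "((\<lambda>s. \<Sum>i\<in>UNIV. w i (u s) * v s $ i) has_real_derivative
      (\<Sum>i\<in>UNIV. (\<Sum>k\<in>UNIV. pderiv_at k (w i) (u t) * v t $ k) * v t $ i + a $ i * w i (u t))) (at t)"
    by (intro DERIV_sum DERIV_mult has_real_derivative_along_curve[OF w ut u] vi)
  moreover have "(\<Sum>i\<in>UNIV. (\<Sum>k\<in>UNIV. pderiv_at k (w i) (u t) * v t $ k) * v t $ i + a $ i * w i (u t)) =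
      (\<Sum>j\<in>UNIV. \<Sum>i\<in>UNIV. nabla1 G w j i (u t) * v t $ j * v t $ i)"
  proof -
    let ?\<Gamma> = "\<lambda>l j i. christoffel G l j i (u t)"
    have "(\<Sum>l\<in>UNIV. a $ l * w l (u t)) =
        - (\<Sum>l\<in>UNIV. \<Sum>j\<in>UNIV. \<Sum>i\<in>UNIV. ?\<Gamma> l j i * w l (u t) * v t $ j * v t $ i)"
      unfolding geo by (simp add: sum_negf sum_distrib_right sum_distrib_left mult_ac)
    also have "\<dots> = - (\<Sum>j\<in>UNIV. \<Sum>l\<in>UNIV. \<Sum>i\<in>UNIV. ?\<Gamma> l j i * w l (u t) * v t $ j * v t $ i)"
      by (subst sum.swap) rule
    also have "\<dots> = - (\<Sum>j\<in>UNIV. \<Sum>i\<in>UNIV. \<Sum>l\<in>UNIV. ?\<Gamma> l j i * w l (u t) * v t $ j * v t $ i)"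
      by (intro arg_cong[where f = uminus] sum.cong refl sum.swap)
    finally have acc: "(\<Sum>l\<in>UNIV. a $ l * w l (u t)) =
        - (\<Sum>j\<in>UNIV. \<Sum>i\<in>UNIV. \<Sum>l\<in>UNIV. ?\<Gamma> l j i * w l (u t) * v t $ j * v t $ i)" .
    have "(\<Sum>i\<in>UNIV. (\<Sum>k\<in>UNIV. pderiv_at k (w i) (u t) * v t $ k) * v t $ i) =
        (\<Sum>i\<in>UNIV. \<Sum>j\<in>UNIV. pderiv_at j (w i) (u t) * v t $ j * v t $ i)"
      by (simp add: sum_distrib_right)
    also have "\<dots> = (\<Sum>j\<in>UNIV. \<Sum>i\<in>UNIV. pderiv_at j (w i) (u t) * v t $ j * v t $ i)"
      by (rule sum.swap)
    finally show ?thesis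
      unfolding sum.distrib acc nabla1_def
      by (simp add: sum_distrib_right left_diff_distrib sum_subtractf)
  qed
  ultimately show ?thesis by simp
qed

lemma tensor_derivative_along_geodesic:
  fixes T :: "'n::finite \<Rightarrow> 'n \<Rightarrow> real^'n \<Rightarrow> real"
  assumes T: "\<And>j i. smooth_on S (T j i)" and ut: "u t \<in> S"
    and u: "(u has_vector_derivative v t) (at t)" and v: "(v has_vector_derivative a) (at t)"
    and geo: "\<And>k. a $ k = - (\<Sum>i\<in>UNIV. \<Sum>j\<in>UNIV. christoffel G k i j (u t) * v t $ i * v t $ j)"
  shows "((\<lambda>s. \<Sum>j\<in>UNIV. \<Sum>i\<in>UNIV. T j i (u s) * v s $ j * v s $ i) has_real_derivative
    (\<Sum>k\<in>UNIV. \<Sum>j\<in>UNIV. \<Sum>i\<in>UNIV. nabla2 G T k j i (u t) * v t $ k * v t $ j * v t $ i)) (at t)"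
proof -
  have vi: "((\<lambda>s. v s $ i) has_real_derivative a $ i) (at t)" for i
    using bounded_linear.has_vector_derivative[OF bounded_linear_vec_nth v]
    by (simp add: has_real_derivative_iff_has_vector_derivative)
  let ?P = "\<lambda>k j i. pderiv_at k (T j i) (u t)" and ?T = "\<lambda>j i. T j i (u t)" and ?v = "v t"
  let ?\<Gamma> = "\<lambda>l j i. christoffel G l j i (u t)"
  have "((\<lambda>s. \<Sum>j\<in>UNIV. \<Sum>i\<in>UNIV. T j i (u s) * v s $ j * v s $ i) has_real_derivative
      (\<Sum>j\<in>UNIV. \<Sum>i\<in>UNIV. ((\<Sum>k\<in>UNIV. ?P k j i * ?v $ k) * ?v $ j + a $ j * ?T j i) * ?v $ i
        + a $ i * (?T j i * ?v $ j))) (at t)"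
    by (intro DERIV_sum DERIV_mult has_real_derivative_along_curve[OF T ut u] vi)
  moreover have "(\<Sum>j\<in>UNIV. \<Sum>i\<in>UNIV. ((\<Sum>k\<in>UNIV. ?P k j i * ?v $ k) * ?v $ j + a $ j * ?T j i) * ?v $ i
        + a $ i * (?T j i * ?v $ j)) =
      (\<Sum>k\<in>UNIV. \<Sum>j\<in>UNIV. \<Sum>i\<in>UNIV. nabla2 G T k j i (u t) * ?v $ k * ?v $ j * ?v $ i)"
  proof -
    have 1: "(\<Sum>j\<in>UNIV. \<Sum>i\<in>UNIV. (\<Sum>k\<in>UNIV. ?P k j i * ?v $ k) * ?v $ j * ?v $ i) =
        (\<Sum>k\<in>UNIV. \<Sum>j\<in>UNIV. \<Sum>i\<in>UNIV. ?P k j i * ?v $ k * ?v $ j * ?v $ i)"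
    proof -
      have "(\<Sum>j\<in>UNIV. \<Sum>i\<in>UNIV. (\<Sum>k\<in>UNIV. ?P k j i * ?v $ k) * ?v $ j * ?v $ i) =
          (\<Sum>j\<in>UNIV. \<Sum>i\<in>UNIV. \<Sum>k\<in>UNIV. ?P k j i * ?v $ k * ?v $ j * ?v $ i)"
        by (simp add: sum_distrib_right)
      also have "\<dots> = (\<Sum>j\<in>UNIV. \<Sum>k\<in>UNIV. \<Sum>i\<in>UNIV. ?P k j i * ?v $ k * ?v $ j * ?v $ i)"
        by (intro sum.cong refl sum.swap)
      also have "\<dots> = (\<Sum>k\<in>UNIV. \<Sum>j\<in>UNIV. \<Sum>i\<in>UNIV. ?P k j i * ?v $ k * ?v $ j * ?v $ i)"
        by (rule sum.swap)
      finally show ?thesis .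
    qed
    \<comment> \<open>the acceleration in the first slot and in the second slot of the tensor\<close>
    have 2: "(\<Sum>l\<in>UNIV. \<Sum>i\<in>UNIV. a $ l * ?T l i * ?v $ i) =
        - (\<Sum>k\<in>UNIV. \<Sum>j\<in>UNIV. \<Sum>i\<in>UNIV. (\<Sum>l\<in>UNIV. ?\<Gamma> l k j * ?T l i) * ?v $ k * ?v $ j * ?v $ i)"
    proof -
      let ?s = "\<lambda>l i k j. ?\<Gamma> l k j * ?T l i * ?v $ k * ?v $ j * ?v $ i"
      have "(\<Sum>l\<in>UNIV. \<Sum>i\<in>UNIV. a $ l * ?T l i * ?v $ i) =
          - (\<Sum>l\<in>UNIV. \<Sum>i\<in>UNIV. \<Sum>k\<in>UNIV. \<Sum>j\<in>UNIV. ?s l i k j)"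
        unfolding geo by (simp add: sum_negf sum_distrib_right sum_distrib_left mult_ac)
      also have "(\<Sum>l\<in>UNIV. \<Sum>i\<in>UNIV. \<Sum>k\<in>UNIV. \<Sum>j\<in>UNIV. ?s l i k j) =
          (\<Sum>l\<in>UNIV. \<Sum>k\<in>UNIV. \<Sum>i\<in>UNIV. \<Sum>j\<in>UNIV. ?s l i k j)"
        by (intro sum.cong refl sum.swap)
      also have "\<dots> = (\<Sum>k\<in>UNIV. \<Sum>l\<in>UNIV. \<Sum>i\<in>UNIV. \<Sum>j\<in>UNIV. ?s l i k j)"
        by (rule sum.swap)
      also have "\<dots> = (\<Sum>k\<in>UNIV. \<Sum>l\<in>UNIV. \<Sum>j\<in>UNIV. \<Sum>i\<in>UNIV. ?s l i k j)"
        by (intro sum.cong refl sum.swap)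
      also have "\<dots> = (\<Sum>k\<in>UNIV. \<Sum>j\<in>UNIV. \<Sum>l\<in>UNIV. \<Sum>i\<in>UNIV. ?s l i k j)"
        by (intro sum.cong refl sum.swap)
      also have "\<dots> = (\<Sum>k\<in>UNIV. \<Sum>j\<in>UNIV. \<Sum>i\<in>UNIV. \<Sum>l\<in>UNIV. ?s l i k j)"
        by (intro sum.cong refl sum.swap)
      finally show ?thesis by (simp add: sum_distrib_right)
    qed
    have 3: "(\<Sum>j\<in>UNIV. \<Sum>l\<in>UNIV. a $ l * (?T j l * ?v $ j)) =
        - (\<Sum>k\<in>UNIV. \<Sum>j\<in>UNIV. \<Sum>i\<in>UNIV. (\<Sum>l\<in>UNIV. ?\<Gamma> l k i * ?T j l) * ?v $ k * ?v $ j * ?v $ i)"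
    proof -
      let ?s = "\<lambda>j l k i. ?\<Gamma> l k i * ?T j l * ?v $ k * ?v $ j * ?v $ i"
      have "(\<Sum>j\<in>UNIV. \<Sum>l\<in>UNIV. a $ l * (?T j l * ?v $ j)) =
          - (\<Sum>j\<in>UNIV. \<Sum>l\<in>UNIV. \<Sum>k\<in>UNIV. \<Sum>i\<in>UNIV. ?s j l k i)"
        unfolding geo by (simp add: sum_negf sum_distrib_right sum_distrib_left mult_ac)
      also have "(\<Sum>j\<in>UNIV. \<Sum>l\<in>UNIV. \<Sum>k\<in>UNIV. \<Sum>i\<in>UNIV. ?s j l k i) =
          (\<Sum>j\<in>UNIV. \<Sum>k\<in>UNIV. \<Sum>l\<in>UNIV. \<Sum>i\<in>UNIV. ?s j l k i)"
        by (intro sum.cong refl sum.swap)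
      also have "\<dots> = (\<Sum>k\<in>UNIV. \<Sum>j\<in>UNIV. \<Sum>l\<in>UNIV. \<Sum>i\<in>UNIV. ?s j l k i)"
        by (rule sum.swap)
      also have "\<dots> = (\<Sum>k\<in>UNIV. \<Sum>j\<in>UNIV. \<Sum>i\<in>UNIV. \<Sum>l\<in>UNIV. ?s j l k i)"
        by (intro sum.cong refl sum.swap)
      finally show ?thesis by (simp add: sum_distrib_right)
    qed
    show ?thesis
      unfolding distrib_right sum.distrib 1 2 3 nabla2_def left_diff_distrib sum_subtractf by simp
  qed
  ultimately show ?thesis by simp
qed

lemma tanno_contraction_null:
  fixes M :: "real^'n::finite^'n" and d :: "'n \<Rightarrow> real"
  assumes null: "v \<bullet> (M *v v) = 0"
    and eq: "\<And>i j k. N k j i + 2 * d k * M $ i $ j + d i * M $ j $ k + d j * M $ i $ k = 0"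
  shows "(\<Sum>k\<in>UNIV. \<Sum>j\<in>UNIV. \<Sum>i\<in>UNIV. N k j i * v $ k * v $ j * v $ i) = 0"
proof -
  let ?S = "\<lambda>f. \<Sum>k\<in>UNIV. \<Sum>j\<in>UNIV. \<Sum>i\<in>UNIV. f k j i * v $ k * v $ j * (v $ i :: real)"
  have q: "(\<Sum>i\<in>UNIV. \<Sum>j\<in>UNIV. M $ i $ j * v $ i * v $ j) = 0"
    using null unfolding form_eq_sum .
  have q': "(\<Sum>j\<in>UNIV. \<Sum>i\<in>UNIV. M $ i $ j * v $ i * v $ j) = 0"
    using q by (subst sum.swap)
  have 1: "?S (\<lambda>k j i. d k * M $ i $ j) = 0"
  proof -
    have "?S (\<lambda>k j i. d k * M $ i $ j) =
        (\<Sum>k\<in>UNIV. d k * v $ k * (\<Sum>j\<in>UNIV. \<Sum>i\<in>UNIV. M $ i $ j * v $ i * v $ j))"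
      by (simp add: sum_distrib_left mult_ac)
    then show ?thesis by (simp add: q')
  qed
  have 2: "?S (\<lambda>k j i. d j * M $ i $ k) = 0"
  proof -
    have "?S (\<lambda>k j i. d j * M $ i $ k) =
        (\<Sum>j\<in>UNIV. \<Sum>k\<in>UNIV. \<Sum>i\<in>UNIV. d j * M $ i $ k * v $ k * v $ j * v $ i)"
      by (rule sum.swap)
    also have "\<dots> = (\<Sum>j\<in>UNIV. d j * v $ j * (\<Sum>k\<in>UNIV. \<Sum>i\<in>UNIV. M $ i $ k * v $ i * v $ k))"
      by (simp add: sum_distrib_left mult_ac)
    finally show ?thesis by (simp add: q')
  qed
  have 3: "?S (\<lambda>k j i. d i * M $ j $ k) = 0"
  proof -
    have "?S (\<lambda>k j i. d i * M $ j $ k) =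
        (\<Sum>k\<in>UNIV. \<Sum>j\<in>UNIV. M $ j $ k * v $ j * v $ k * (\<Sum>i\<in>UNIV. d i * v $ i))"
      by (simp add: sum_distrib_left mult_ac)
    also have "\<dots> = (\<Sum>k\<in>UNIV. \<Sum>j\<in>UNIV. M $ j $ k * v $ j * v $ k) * (\<Sum>i\<in>UNIV. d i * v $ i)"
      by (simp add: sum_distrib_right)
    finally show ?thesis by (simp add: q')
  qed
  have N: "N k j i * v $ k * v $ j * v $ i = (- 2) * (d k * M $ i $ j * v $ k * v $ j * v $ i)
      - d i * M $ j $ k * v $ k * v $ j * v $ i - d j * M $ i $ k * v $ k * v $ j * v $ i" for k j i
  proof -
    have N: "N k j i = (- 2) * (d k * M $ i $ j) - d i * M $ j $ k - d j * M $ i $ k"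
      using eq[of k j i] by simp
    show ?thesis unfolding N by (simp only: left_diff_distrib mult.assoc)
  qed
  have "?S N = (- 2) * ?S (\<lambda>k j i. d k * M $ i $ j) - ?S (\<lambda>k j i. d i * M $ j $ k)
      - ?S (\<lambda>k j i. d j * M $ i $ k)"
    unfolding N by (simp only: sum_subtractf sum_distrib_left)
  then show ?thesis by (simp add: 1 2 3)
qed

lemma smooth_on_nabla1:
  fixes G :: "real^'n::finite \<Rightarrow> real^'n^'n"
  assumes S: "open S" and G: "smooth_on S G" and inv: "\<And>x. x \<in> S \<Longrightarrow> invertible (G x)"
    and w: "\<And>i. smooth_on S (w i)"
  shows "smooth_on S (nabla1 G w j i)"
  using smooth_on_pderiv_at[OF w] smooth_on_christoffel[OF S G inv] w
  unfolding smooth_on_def nabla1_def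
  by (intro allI C_k_on_diff C_k_on_sum C_k_on_mult S) auto

text \<open>The function along a null geodesic has vanishing third derivative: the third covariant
  derivative is a sum of multiples of the metric, and these vanish on the null velocity.\<close>

lemma tanno_third_derivative_along_null_geodesic:
  fixes G :: "real^'n::finite \<Rightarrow> real^'n^'n" and L :: "real^'n \<Rightarrow> real"
  assumes S: "open S" and G: "smooth_on S G" and inv: "\<And>x. x \<in> S \<Longrightarrow> invertible (G x)"
    and L: "smooth_on S L"
    and tanno: "\<And>x i j k. x \<in> S \<Longrightarrow> nabla2 G (nabla1 G (differential L)) k j i x
      + 2 * differential L k x * G x $ i $ j + differential L i x * G x $ j $ k
      + differential L j x * G x $ i $ k = 0"
    and J: "open J" and u: "smooth_on J u" and uS: "u ` J \<subseteq> S"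
    and geo: "\<And>t k. t \<in> J \<Longrightarrow> velocity (velocity u) t $ k + (\<Sum>i\<in>UNIV. \<Sum>j\<in>UNIV.
      christoffel G k i j (u t) * velocity u t $ i * velocity u t $ j) = 0"
    and null: "\<And>t. t \<in> J \<Longrightarrow> velocity u t \<bullet> (G (u t) *v velocity u t) = 0"
  obtains h1 h2 where
    "\<And>t. t \<in> J \<Longrightarrow> ((\<lambda>t. L (u t)) has_real_derivative h1 t) (at t)"
    "\<And>t. t \<in> J \<Longrightarrow> (h1 has_real_derivative h2 t) (at t)"
    "\<And>t. t \<in> J \<Longrightarrow> (h2 has_real_derivative 0) (at t)"
proof
  let ?w = "differential L" and ?v = "velocity u"
  have w: "smooth_on S (?w i)" for i
    using smooth_on_pderiv_at[OF L, of i] unfolding differential_def[abs_def] .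
  fix t assume t: "t \<in> J"
  have ut: "u t \<in> S" using t uS by blast
  have u': "(u has_vector_derivative ?v t) (at t)" "(?v has_vector_derivative velocity ?v t) (at t)"
    by (rule has_vector_derivative_velocity[OF u t]
        has_vector_derivative_velocity[OF smooth_on_velocity[OF J u] t])+
  have geo': "velocity ?v t $ k = - (\<Sum>i\<in>UNIV. \<Sum>j\<in>UNIV.
      christoffel G k i j (u t) * ?v t $ i * ?v t $ j)" for k
    using geo[OF t, of k] by linarith
  show "((\<lambda>t. L (u t)) has_real_derivative (\<Sum>i\<in>UNIV. ?w i (u t) * ?v t $ i)) (at t)"
    unfolding differential_def by (rule has_real_derivative_along_curve[OF L ut u'(1)])
  show "((\<lambda>t. \<Sum>i\<in>UNIV. ?w i (u t) * ?v t $ i) has_real_derivative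
      (\<Sum>j\<in>UNIV. \<Sum>i\<in>UNIV. nabla1 G ?w j i (u t) * ?v t $ j * ?v t $ i)) (at t)"
    by (rule covector_derivative_along_geodesic[OF w ut u' geo'])
  show "((\<lambda>t. \<Sum>j\<in>UNIV. \<Sum>i\<in>UNIV. nabla1 G ?w j i (u t) * ?v t $ j * ?v t $ i) has_real_derivative 0) (at t)"
    using tensor_derivative_along_geodesic[where T = "nabla1 G ?w", OF smooth_on_nabla1[OF S G inv w] ut u' geo']
      tanno_contraction_null[OF null[OF t], where d = "\<lambda>k. ?w k (u t)", OF tanno[OF ut]]
    by simp
qed

text \<open>A function on the line with vanishing third derivative is a quadratic polynomial, and a bounded
  polynomial is constant.\<close>

lemma bounded_third_derivative_zero:
  fixes h :: "real \<Rightarrow> real"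
  assumes h: "\<And>t. (h has_real_derivative h1 t) (at t)" "\<And>t. (h1 has_real_derivative h2 t) (at t)"
      "\<And>t. (h2 has_real_derivative 0) (at t)"
    and bound: "\<And>t. \<bar>h t\<bar> \<le> C"
  shows "h1 t = 0"
proof -
  have h2: "h2 t = h2 0" for t using DERIV_isconst_all[of h2 t 0] h(3) by blast
  have h1: "h1 t = h1 0 + h2 0 * t" for t
  proof -
    have "((\<lambda>t. h1 t - h2 0 * t) has_real_derivative 0) (at t)" for t
      by (auto intro!: derivative_eq_intros h(2) simp: h2[of t])
    then have "h1 t - h2 0 * t = h1 0 - h2 0 * 0" using DERIV_isconst_all by blast
    then show ?thesis by simp
  qed
  have quad: "h t = h 0 + h1 0 * t + h2 0 * t\<^sup>2 / 2" for t
  proof -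
    have "((\<lambda>t. h t - h1 0 * t - h2 0 * t\<^sup>2 / 2) has_real_derivative 0) (at t)" for t
      by (auto intro!: derivative_eq_intros h(1) simp: h1[of t])
    then have "h t - h1 0 * t - h2 0 * t\<^sup>2 / 2 = h 0 - h1 0 * 0 - h2 0 * 0\<^sup>2 / 2"
      using DERIV_isconst_all by blast
    then show ?thesis by simp
  qed
  have C: "C \<ge> 0" using bound[of 0] by linarith
  \<comment> \<open>comparing \<open>h\<close> at \<open>s\<close> and \<open>- s\<close> separates the linear from the quadratic term\<close>
  have lin: "\<bar>h1 0\<bar> * s \<le> C" if "s \<ge> 0" for s
  proof -
    have "2 * (h1 0 * s) = h s - h (- s)" using quad[of s] quad[of "- s"] by simp
    then have "\<bar>h1 0 * s\<bar> \<le> C" using bound[of s] bound[of "- s"] by linarith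
    then show ?thesis using that by (simp add: abs_mult)
  qed
  have sq: "\<bar>h2 0\<bar> * s\<^sup>2 \<le> 4 * C" for s
  proof -
    have "h2 0 * s\<^sup>2 = h s + h (- s) - 2 * h 0" using quad[of s] quad[of "- s"] by simp
    then have "\<bar>h2 0 * s\<^sup>2\<bar> \<le> 4 * C" using bound[of s] bound[of "- s"] bound[of 0] by linarith
    then show ?thesis by (simp add: abs_mult)
  qed
  have "h1 0 = 0"
  proof (rule ccontr)
    assume nz: "h1 0 \<noteq> 0"
    then show False using lin[of "(C + 1) / \<bar>h1 0\<bar>"] C by simp
  qed
  moreover have "h2 0 = 0"
  proof (rule ccontr)
    assume nz: "h2 0 \<noteq> 0"
    then show False using sq[of "sqrt ((4 * C + 1) / \<bar>h2 0\<bar>)"] C by simp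
  qed
  ultimately show ?thesis by (simp add: h1[of t])
qed

section \<open>Null vectors of indefinite forms\<close>

text \<open>Through a positive vector \<open>v\<close>, in the direction of a negative vector \<open>w\<close>, there are two null
  vectors \<open>v + s w\<close>; a functional that vanishes at both vanishes at \<open>v\<close>. So it vanishes at all
  positive vectors, by symmetry at all negative ones, and at null vectors by hypothesis.\<close>

lemma functional_zero_on_null_vectors:
  fixes M :: "real^'n::finite^'n" and f :: "real^'n \<Rightarrow> real"
  assumes sym: "transpose M = M" and lin: "linear f"
    and null: "\<And>v. v \<bullet> (M *v v) = 0 \<Longrightarrow> f v = 0"
    and pos: "v \<bullet> (M *v v) > 0" and neg: "w \<bullet> (M *v w) < 0"
  shows "f z = 0"
proof -
  have both: "f v = 0 \<and> f w = 0" if pos: "v \<bullet> (M *v v) > 0" and neg: "w \<bullet> (M *v w) < 0" for v w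
  proof -
    define a b c where "a = w \<bullet> (M *v w)" and "b = v \<bullet> (M *v w)" and "c = v \<bullet> (M *v v)"
    have q: "(v + s *\<^sub>R w) \<bullet> (M *v (v + s *\<^sub>R w)) = a * s\<^sup>2 + 2 * b * s + c" for s
      using form_sym[OF sym, of w v]
      by (simp add: a_def b_def c_def matrix_vector_right_distrib matrix_vector_mult_scaleR
          inner_add_left inner_add_right power2_eq_square algebra_simps)
    define r where "r = sqrt (b\<^sup>2 - a * c)"
    have ac: "a * c < 0" using pos neg by (simp add: a_def c_def mult_neg_pos)
    then have "b\<^sup>2 - a * c > 0" using zero_le_power2[of b] by linarith
    then have r: "r > 0" "r\<^sup>2 = b\<^sup>2 - a * c" by (auto simp: r_def)
    have a: "a \<noteq> 0" using neg by (simp add: a_def)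
    define s1 s2 where "s1 = (- b + r) / a" and "s2 = (- b - r) / a"
    have "a * s1\<^sup>2 + 2 * b * s1 + c = (r\<^sup>2 - b\<^sup>2 + a * c) / a"
      "a * s2\<^sup>2 + 2 * b * s2 + c = (r\<^sup>2 - b\<^sup>2 + a * c) / a"
      using a by (simp_all add: s1_def s2_def field_simps power2_eq_square)
    then have "f (v + s1 *\<^sub>R w) = 0" "f (v + s2 *\<^sub>R w) = 0"
      using r(2) by (auto intro!: null simp: q)
    then have eqs: "f v + s1 * f w = 0" "f v + s2 * f w = 0"
      using lin by (simp_all add: linear_add linear_scale)
    then have "(s1 - s2) * f w = 0" unfolding left_diff_distrib by linarith
    moreover have "s1 - s2 = 2 * r / a" by (simp add: s1_def s2_def diff_divide_distrib[symmetric])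
    ultimately have "f w = 0" using r(1) a by simp
    then show ?thesis using eqs by simp
  qed
  show ?thesis
    using both[of z w] both[of v z] null[of z] pos neg by (cases "z \<bullet> (M *v z)" "0::real" rule: linorder_cases) auto
qed

section \<open>Charts\<close>

locale pseudo_riemannian_manifold =
  fixes X :: "'a topology" and A :: "('a, 'n::finite) chart set" and g :: "('a, 'n) tensor2"
  assumes manifold: "smooth_manifold X A" and metric: "pseudo_riemannian_metric A g"
begin

lemma is_chart: "c \<in> A \<Longrightarrow> is_chart X c"
  using manifold unfolding smooth_manifold_def by blast

lemma topspace_charts: "topspace X = (\<Union>c\<in>A. dom_chart c)"
  using manifold unfolding smooth_manifold_def by blast

lemma open_dom: "c \<in> A \<Longrightarrow> openin X (dom_chart c)"
  using is_chart unfolding is_chart_def by blast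

lemma open_img: "c \<in> A \<Longrightarrow> open (img_chart c)"
  using is_chart unfolding is_chart_def by blast

lemma topspace_dom:
  assumes "c \<in> A"
  shows "topspace (subtopology X (dom_chart c)) = dom_chart c"
  using openin_subset[OF open_dom[OF assms]] by (simp add: Int_absorb1)

lemma coord_homeomorphic:
  "c \<in> A \<Longrightarrow> homeomorphic_map (subtopology X (dom_chart c)) (top_of_set (img_chart c)) (coord c)"
  using is_chart unfolding is_chart_def by blast

lemma inj_on_coord:
  assumes "c \<in> A"
  shows "inj_on (coord c) (dom_chart c)"
  using homeomorphic_imp_injective_map[OF coord_homeomorphic[OF assms]] topspace_dom[OF assms]
  by simp

lemma inv_chart_coord: "c \<in> A \<Longrightarrow> p \<in> dom_chart c \<Longrightarrow> inv_chart c (coord c p) = p"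
  unfolding inv_chart_def by (simp add: inj_on_coord inv_into_f_f)

lemma coord_in_img: "p \<in> dom_chart c \<Longrightarrow> coord c p \<in> img_chart c"
  unfolding img_chart_def by blast

lemma inv_chart_in_dom: "x \<in> img_chart c \<Longrightarrow> inv_chart c x \<in> dom_chart c"
  unfolding inv_chart_def img_chart_def by (rule inv_into_into)

lemma coord_inv_chart: "x \<in> img_chart c \<Longrightarrow> coord c (inv_chart c x) = x"
  unfolding inv_chart_def img_chart_def by (rule f_inv_into_f)

lemma continuous_coord:
  "c \<in> A \<Longrightarrow> continuous_map (subtopology X (dom_chart c)) euclidean (coord c)"
  using homeomorphic_imp_continuous_map[OF coord_homeomorphic] continuous_map_into_fulltopology
  by blast

lemma continuous_inv_chart:
  assumes c: "c \<in> A"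
  shows "continuous_map (top_of_set (img_chart c)) X (inv_chart c)"
proof -
  obtain h where h: "homeomorphic_maps (subtopology X (dom_chart c)) (top_of_set (img_chart c)) (coord c) h"
    using coord_homeomorphic[OF c] unfolding homeomorphic_map_maps by blast
  then have "continuous_map (top_of_set (img_chart c)) X h"
    unfolding homeomorphic_maps_def using continuous_map_into_fulltopology by blast
  then show ?thesis
  proof (rule continuous_map_eq)
    fix x assume x: "x \<in> topspace (top_of_set (img_chart c))"
    then have "h x \<in> dom_chart c" "coord c (h x) = x"
      using h topspace_dom[OF c] unfolding homeomorphic_maps_def
      by (auto dest!: continuous_map_funspace)
    then show "h x = inv_chart c x" using inv_chart_coord[OF c] by metis
  qed
qed

lemma openin_coord_preimage:
  assumes c: "c \<in> A" and U: "open U"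
  shows "openin X {p \<in> dom_chart c. coord c p \<in> U}"
proof -
  have "openin (subtopology X (dom_chart c)) {p \<in> topspace (subtopology X (dom_chart c)). coord c p \<in> U}"
    by (rule openin_continuous_map_preimage[OF continuous_coord[OF c]]) (use U in simp)
  then show ?thesis
    unfolding topspace_dom[OF c] openin_open_subtopology[OF open_dom[OF c]] by blast
qed

lemma open_overlap:
  assumes c: "c \<in> A" and d: "d \<in> A"
  shows "open (overlap c d)"
proof -
  have "open_map (subtopology X (dom_chart c)) (top_of_set (img_chart c)) (coord c)"
    by (rule homeomorphic_imp_open_map[OF coord_homeomorphic[OF c]])
  moreover have "openin (subtopology X (dom_chart c)) (dom_chart c \<inter> dom_chart d)"
    using openin_open_subtopology[OF open_dom[OF c]] open_dom[OF c] open_dom[OF d] by auto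
  ultimately have "openin (top_of_set (img_chart c)) (overlap c d)"
    unfolding open_map_def overlap_def by blast
  then show ?thesis using openin_open_eq[OF open_img[OF c]] by blast
qed

lemma overlap_iff:
  "c \<in> A \<Longrightarrow> x \<in> overlap c d \<longleftrightarrow> x \<in> img_chart c \<and> inv_chart c x \<in> dom_chart d"
  unfolding overlap_def img_chart_def using inv_chart_coord by fastforce

lemma coord_in_overlap: "p \<in> dom_chart c \<Longrightarrow> p \<in> dom_chart d \<Longrightarrow> coord c p \<in> overlap c d"
  unfolding overlap_def by blast

lemma transition_coord: "c \<in> A \<Longrightarrow> p \<in> dom_chart c \<Longrightarrow> transition c d (coord c p) = coord d p"
  by (simp add: transition_def inv_chart_coord)

lemma transition_in_overlap:
  assumes "c \<in> A" "d \<in> A" "x \<in> overlap c d"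
  shows "transition c d x \<in> overlap d c" "transition d c (transition c d x) = x"
    "transition c d x \<in> img_chart d"
  using assms by (auto simp: overlap_def transition_coord img_chart_def)

lemma smooth_transition: "c \<in> A \<Longrightarrow> d \<in> A \<Longrightarrow> smooth_on (overlap c d) (transition c d)"
  using manifold unfolding smooth_manifold_def by blast

lemma surj_transition_derivative:
  assumes c: "c \<in> A" and d: "d \<in> A" and x: "x \<in> overlap c d"
  shows "surj (frechet_derivative (transition c d) (at x))"
proof -
  let ?y = "transition c d x"
  let ?D = "frechet_derivative (transition c d) (at x)" and ?E = "frechet_derivative (transition d c) (at ?y)"
  have "(transition d c has_derivative ?E) (at ?y)"
    by (rule smooth_on_has_derivative[OF smooth_transition[OF d c] transition_in_overlap(1)[OF c d x]])
  moreover have "(transition c d has_derivative ?D) (at (transition d c ?y))"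
    using smooth_on_has_derivative[OF smooth_transition[OF c d] x] transition_in_overlap(2)[OF c d x]
    by simp
  ultimately have "((\<lambda>y. transition c d (transition d c y)) has_derivative (\<lambda>h. ?D (?E h))) (at ?y)"
    by (rule has_derivative_compose)
  then have "((\<lambda>y. y) has_derivative (\<lambda>h. ?D (?E h))) (at ?y)"
    by (rule has_derivative_transform_within_open[OF _ open_overlap[OF d c] transition_in_overlap(1)[OF c d x]])
      (rule transition_in_overlap(2)[OF d c])
  then have "(\<lambda>h. ?D (?E h)) = (\<lambda>h. h)"
    by (rule has_derivative_unique[OF _ has_derivative_ident])
  then show ?thesis by (intro surjI) (rule fun_cong)
qed

lemma metric_symmetric: "c \<in> A \<Longrightarrow> x \<in> img_chart c \<Longrightarrow> transpose (g c x) = g c x"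
  using metric unfolding pseudo_riemannian_metric_def by blast

lemma metric_invertible: "c \<in> A \<Longrightarrow> x \<in> img_chart c \<Longrightarrow> invertible (g c x)"
  using metric unfolding pseudo_riemannian_metric_def by blast

lemma metric_smooth: "c \<in> A \<Longrightarrow> smooth_on (img_chart c) (g c)"
  using metric unfolding pseudo_riemannian_metric_def smooth_tensor2_def by blast

lemma metric_differentiable: "c \<in> A \<Longrightarrow> x \<in> img_chart c \<Longrightarrow> g c differentiable (at x)"
  using smooth_on_has_derivative[OF metric_smooth] unfolding differentiable_def by blast

lemma metric_pullback:
  assumes c: "c \<in> A" and d: "d \<in> A" and x: "x \<in> overlap c d"
  defines "D \<equiv> frechet_derivative (transition c d) (at x)"
  shows "v \<bullet> (g c x *v w) = D v \<bullet> (g d (transition c d x) *v D w)"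
proof -
  let ?J = "jacobian (transition c d) (at x)" and ?H = "g d (transition c d x)"
  have dd: "(transition c d has_derivative D) (at x)"
    unfolding D_def by (rule smooth_on_has_derivative[OF smooth_transition[OF c d] x])
  have J: "?J *v h = D h" for h
    unfolding jacobian_def D_def[symmetric]
    using dd has_derivative_bounded_linear matrix_vector_mul(3) by metis
  have "g c x = transpose ?J ** ?H ** ?J"
    using metric c d x unfolding pseudo_riemannian_metric_def smooth_tensor2_def Let_def by blast
  then have "v \<bullet> (g c x *v w) = v \<bullet> (transpose ?J *v (?H *v (?J *v w)))"
    by (simp add: matrix_vector_mul_assoc matrix_mul_assoc)
  also have "\<dots> = (?J *v v) \<bullet> (?H *v (?J *v w))"
    by (metis dot_lmul_matrix vector_transpose_matrix transpose_transpose)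
  finally show ?thesis unfolding J .
qed

lemma continuous_smooth_function:
  assumes "smooth_function A lam"
  shows "continuous_map X euclideanreal lam"
proof (rule pasting_lemma[where I = A and T = dom_chart and f = "\<lambda>_. lam"])
  fix c assume c: "c \<in> A"
  have "continuous_map (top_of_set (img_chart c)) euclideanreal (in_chart lam c)"
    using assms c smooth_on_imp_continuous_on unfolding smooth_function_def by auto
  then have "continuous_map (subtopology X (dom_chart c)) euclideanreal (in_chart lam c \<circ> coord c)"
    using homeomorphic_imp_continuous_map[OF coord_homeomorphic[OF c]] continuous_map_compose
    by blast
  then show "continuous_map (subtopology X (dom_chart c)) euclideanreal lam"
    by (rule continuous_map_eq)
      (use topspace_dom[OF c] inv_chart_coord[OF c] in \<open>auto simp: in_chart_def\<close>)
qed (use open_dom topspace_charts in auto)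

section \<open>Null geodesics on the manifold\<close>

text \<open>A solution of the geodesic equation in one chart is a geodesic only if it satisfies the equation
  in every chart of the atlas that it meets. This is where the chart change of the Euler--Lagrange
  equation is needed.\<close>

theorem null_geodesic_exists:
  assumes c: "c \<in> A" and x: "x \<in> img_chart c" and null: "v \<bullet> (g c x *v v) = 0"
  obtains a u where "a > 0" "smooth_on {-a<..<a} u" "u 0 = x" "velocity u 0 = v"
    "\<And>t. u t \<in> img_chart c"
    "light_line_geodesic_on X A g {-a<..<a} (\<lambda>t. inv_chart c (u t))"
proof -
  obtain a u where a: "a > 0" and u: "smooth_on {-a<..<a} u" and init: "u 0 = x" "velocity u 0 = v"
    and uS: "\<And>t. u t \<in> img_chart c"
    and EL: "\<And>t. t \<in> {-a<..<a} \<Longrightarrow> euler_lagrange (g c) (u t) (velocity u t) (velocity (velocity u) t)"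
    and u_null: "\<And>t. t \<in> {-a<..<a} \<Longrightarrow> velocity u t \<bullet> (g c (u t) *v velocity u t) = 0"
    using null_geodesic_in_coordinates[OF open_img[OF c] metric_smooth[OF c]
        metric_symmetric[OF c] metric_invertible[OF c] x null] by metis
  let ?I = "{-a<..<a}" and ?\<gamma> = "\<lambda>t. inv_chart c (u t)"
  have cont: "continuous_map (top_of_set ?I) X ?\<gamma>"
    using continuous_map_compose[OF _ continuous_inv_chart[OF c], of "top_of_set ?I" u]
      smooth_on_imp_continuous_on[OF u] uS
    by (auto simp: o_def continuous_map_in_subtopology)
  have in_d: "smooth_on {t \<in> ?I. ?\<gamma> t \<in> dom_chart d} (local_curve d ?\<gamma>)"
    "\<And>t. t \<in> ?I \<Longrightarrow> ?\<gamma> t \<in> dom_chart d \<Longrightarrow> euler_lagrange (g d) (local_curve d ?\<gamma> t)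
      (velocity (local_curve d ?\<gamma>) t) (velocity (velocity (local_curve d ?\<gamma>)) t)"
    "\<And>t. t \<in> ?I \<Longrightarrow> ?\<gamma> t \<in> dom_chart d \<Longrightarrow> velocity (local_curve d ?\<gamma>) t \<bullet>
      (g d (local_curve d ?\<gamma> t) *v velocity (local_curve d ?\<gamma>) t) = 0"
    if d: "d \<in> A" for d
  proof -
    let ?W = "overlap c d" and ?\<phi> = "transition c d" and ?J = "{t \<in> ?I. ?\<gamma> t \<in> dom_chart d}"
    have curve: "local_curve d ?\<gamma> = (\<lambda>t. ?\<phi> (u t))"
      by (simp add: local_curve_def transition_def o_def)
    have J: "?J = ?I \<inter> u -` ?W" using overlap_iff[OF c, where d = d] uS by auto
    have oJ: "open ?J"
      unfolding J using smooth_on_imp_continuous_on[OF u] open_overlap[OF c d]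
      by (intro continuous_open_preimage) auto
    have uJ: "smooth_on ?J u" by (rule smooth_on_subset[OF u]) auto
    have uW: "u ` ?J \<subseteq> ?W" unfolding J by auto
    have W: "open ?W" "smooth_on ?W ?\<phi>"
      by (rule open_overlap[OF c d] smooth_transition[OF c d])+
    show "smooth_on ?J (local_curve d ?\<gamma>)"
      unfolding curve by (rule smooth_on_compose[OF oJ W(1) uW W(2) uJ])
    fix t assume "t \<in> ?I" "?\<gamma> t \<in> dom_chart d"
    then have t: "t \<in> ?J" "t \<in> ?I" "u t \<in> ?W" using J by auto
    have vel: "velocity (\<lambda>t. ?\<phi> (u t)) t = frechet_derivative ?\<phi> (at (u t)) (velocity u t)"
      by (rule velocity_compose[OF oJ uJ t(1) W(2) uW])
    show "velocity (local_curve d ?\<gamma>) t \<bullet>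
      (g d (local_curve d ?\<gamma> t) *v velocity (local_curve d ?\<gamma>) t) = 0"
      unfolding curve vel metric_pullback[OF c d t(3), symmetric] by (rule u_null[OF t(2)])
    note phi_u = transition_in_overlap(3)[OF c d t(3)]
    show "euler_lagrange (g d) (local_curve d ?\<gamma> t)
      (velocity (local_curve d ?\<gamma>) t) (velocity (velocity (local_curve d ?\<gamma>)) t)"
      unfolding curve vel acceleration_compose[OF oJ t(1) uJ W uW]
      by (rule euler_lagrange_chart_change[OF W(1) t(3) W(2) metric_differentiable[OF c uS]
            metric_differentiable[OF d phi_u] metric_pullback[OF c d] metric_symmetric[OF d phi_u]
            surj_transition_derivative[OF c d t(3)] EL[OF t(2)]])
  qed
  have "light_line_geodesic_on X A g ?I ?\<gamma>"
    unfolding light_line_geodesic_on_def geodesic_on_def Let_def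
  proof (intro conjI ballI impI cont)
    fix d assume d: "d \<in> A"
    show "smooth_on {t \<in> ?I. ?\<gamma> t \<in> dom_chart d} (local_curve d ?\<gamma>)" by (rule in_d(1)[OF d])
    show "\<forall>k. velocity (velocity (local_curve d ?\<gamma>)) t $ k +
        (\<Sum>i\<in>UNIV. \<Sum>j\<in>UNIV. christoffel (g d) k i j (local_curve d ?\<gamma> t) *
           velocity (local_curve d ?\<gamma>) t $ i * velocity (local_curve d ?\<gamma>) t $ j) = 0"
      if "t \<in> {t \<in> ?I. ?\<gamma> t \<in> dom_chart d}" for t
    proof -
      have y: "local_curve d ?\<gamma> t \<in> img_chart d"
        using that by (simp add: local_curve_def coord_in_img)
      show ?thesis
        using in_d(2)[OF d] that geodesic_equation_iff_euler_lagrange[OF open_img[OF d] y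
            metric_differentiable[OF d y] metric_symmetric[OF d] metric_invertible[OF d y]] by blast
    qed
    show "velocity (local_curve d ?\<gamma>) t \<bullet>
        (g d (local_curve d ?\<gamma> t) *v velocity (local_curve d ?\<gamma>) t) = 0"
      if "t \<in> ?I" "?\<gamma> t \<in> dom_chart d" for t
      by (rule in_d(3)[OF d that])
  qed
  then show thesis by (rule that[OF a u init uS])
qed

text \<open>Along a complete null geodesic the function has vanishing third derivative and is bounded by
  compactness, so its first derivative vanishes, in particular at the starting point.\<close>

theorem tanno_derivative_zero_on_null_vectors:
  assumes complete: "light_line_complete X A g" and compact: "compact_space X"
    and lam: "smooth_function A lam" and tanno: "tanno_equation A g lam"
    and c: "c \<in> A" and x: "x \<in> img_chart c" and null: "v \<bullet> (g c x *v v) = 0"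
  shows "frechet_derivative (in_chart lam c) (at x) v = 0"
proof -
  obtain a u where a: "a > 0" and u: "smooth_on {-a<..<a} u" and init: "u 0 = x" "velocity u 0 = v"
    and uS: "\<And>t. u t \<in> img_chart c"
    and geo: "light_line_geodesic_on X A g {-a<..<a} (\<lambda>t. inv_chart c (u t))"
    using null_geodesic_exists[OF c x null] by metis
  have "open {-a<..<a}" "is_interval {-a<..<a}" "{-a<..<a} \<noteq> {}"
    using a by (auto simp: is_interval_oo)
  then obtain \<gamma> where gamma: "light_line_geodesic_on X A g UNIV \<gamma>"
    and ext: "\<And>t. t \<in> {-a<..<a} \<Longrightarrow> \<gamma> t = inv_chart c (u t)"
    using complete geo unfolding light_line_complete_def by blast
  have cont: "continuous_map euclidean X \<gamma>"
    using gamma unfolding light_line_geodesic_on_def geodesic_on_def by simp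
  have in_X: "\<gamma> t \<in> topspace X" for t
    using continuous_map_image_subset_topspace[OF cont] by auto
  let ?h = "\<lambda>t. lam (\<gamma> t)"
  have local: "\<exists>J h1 h2. open J \<and> t \<in> J \<and> (\<forall>s\<in>J. (?h has_real_derivative h1 s) (at s) \<and>
      (h1 has_real_derivative h2 s) (at s) \<and> (h2 has_real_derivative 0) (at s))" for t
  proof -
    obtain d where d: "d \<in> A" "\<gamma> t \<in> dom_chart d" using in_X[of t] topspace_charts by blast
    let ?w = "local_curve d \<gamma>" and ?J = "{s. \<gamma> s \<in> dom_chart d}"
    have J: "open ?J"
      using openin_continuous_map_preimage[OF cont open_dom[OF d(1)]] by simp
    have w: "smooth_on ?J ?w"
      and geo: "\<And>s k. s \<in> ?J \<Longrightarrow> velocity (velocity ?w) s $ k + (\<Sum>i\<in>UNIV. \<Sum>j\<in>UNIV.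
        christoffel (g d) k i j (?w s) * velocity ?w s $ i * velocity ?w s $ j) = 0"
      and nul: "\<And>s. s \<in> ?J \<Longrightarrow> velocity ?w s \<bullet> (g d (?w s) *v velocity ?w s) = 0"
      using gamma d(1) unfolding light_line_geodesic_on_def geodesic_on_def Let_def by auto
    have wS: "?w ` ?J \<subseteq> img_chart d" by (auto simp: local_curve_def coord_in_img)
    have L: "smooth_on (img_chart d) (in_chart lam d)"
      using lam d(1) unfolding smooth_function_def by blast
    have eq: "nabla2 (g d) (nabla1 (g d) (differential (in_chart lam d))) k j i x
      + 2 * differential (in_chart lam d) k x * g d x $ i $ j
      + differential (in_chart lam d) i x * g d x $ j $ k
      + differential (in_chart lam d) j x * g d x $ i $ k = 0" if "x \<in> img_chart d" for x i j k
      using tanno d(1) that unfolding tanno_equation_def Let_def by blast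
    obtain h1 h2 where h: "\<And>s. s \<in> ?J \<Longrightarrow> ((\<lambda>s. in_chart lam d (?w s)) has_real_derivative h1 s) (at s)"
      "\<And>s. s \<in> ?J \<Longrightarrow> (h1 has_real_derivative h2 s) (at s)"
      "\<And>s. s \<in> ?J \<Longrightarrow> (h2 has_real_derivative 0) (at s)"
      using tanno_third_derivative_along_null_geodesic[OF open_img[OF d(1)] metric_smooth[OF d(1)]
          metric_invertible[OF d(1)] L eq J w wS geo nul] by metis
    have "(?h has_real_derivative h1 s) (at s)" if "s \<in> ?J" for s
    proof (rule has_field_derivative_transform_within_open[OF h(1)[OF that] J that])
      fix r assume "r \<in> ?J"
      then show "in_chart lam d (?w r) = lam (\<gamma> r)"
        by (simp add: in_chart_def local_curve_def inv_chart_coord[OF d(1)])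
    qed
    then show ?thesis using J d(2) h(2,3) by blast
  qed
  \<comment> \<open>the derivatives found in the charts are those of the function on the line\<close>
  have derivs: "(?h has_real_derivative deriv ?h t) (at t)"
    "(deriv ?h has_real_derivative deriv (deriv ?h) t) (at t)"
    "(deriv (deriv ?h) has_real_derivative 0) (at t)" for t
  proof -
    obtain J h1 h2 where J: "open J" "t \<in> J"
      and h: "\<And>s. s \<in> J \<Longrightarrow> (?h has_real_derivative h1 s) (at s)"
        "\<And>s. s \<in> J \<Longrightarrow> (h1 has_real_derivative h2 s) (at s)"
        "\<And>s. s \<in> J \<Longrightarrow> (h2 has_real_derivative 0) (at s)"
      using local[of t] by blast
    have 1: "deriv ?h s = h1 s" if "s \<in> J" for s using h(1)[OF that] by (rule DERIV_imp_deriv)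
    have d2: "(deriv ?h has_real_derivative h2 s) (at s)" if "s \<in> J" for s
      by (rule has_field_derivative_transform_within_open[OF h(2)[OF that] J(1) that]) (simp add: 1)
    have 2: "deriv (deriv ?h) s = h2 s" if "s \<in> J" for s using d2[OF that] by (rule DERIV_imp_deriv)
    show "(?h has_real_derivative deriv ?h t) (at t)"
      "(deriv ?h has_real_derivative deriv (deriv ?h) t) (at t)"
      using h(1)[OF J(2)] d2[OF J(2)] 1[OF J(2)] 2[OF J(2)] by simp_all
    show "(deriv (deriv ?h) has_real_derivative 0) (at t)"
      by (rule has_field_derivative_transform_within_open[OF h(3)[OF J(2)] J]) (simp add: 2)
  qed
  have "compactin euclideanreal (lam ` topspace X)"
    using compact continuous_smooth_function[OF lam] unfolding compact_space_def
    by (rule image_compactin)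
  then have "bounded (lam ` topspace X)" by (simp add: compact_imp_bounded)
  then obtain C where "\<And>p. p \<in> topspace X \<Longrightarrow> \<bar>lam p\<bar> \<le> C"
    unfolding bounded_iff by auto
  then have "\<bar>?h t\<bar> \<le> C" for t using in_X by blast
  then have "deriv ?h 0 = 0" by (rule bounded_third_derivative_zero[OF derivs])
  then have h0: "(?h has_real_derivative 0) (at 0)" using derivs(1)[of 0] by simp
  have L: "(in_chart lam c has_derivative frechet_derivative (in_chart lam c) (at x)) (at (u 0))"
    using lam c x init(1) smooth_on_has_derivative unfolding smooth_function_def by blast
  have "(u has_vector_derivative v) (at 0)"
    using has_vector_derivative_velocity[OF u, of 0] a init(2) by simp
  from vector_derivative_diff_chain_within[OF this has_derivative_at_withinI[OF L]]
  have "((\<lambda>t. in_chart lam c (u t)) has_real_derivative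
      frechet_derivative (in_chart lam c) (at x) v) (at 0)"
    by (simp add: o_def has_real_derivative_iff_has_vector_derivative)
  then have "(?h has_real_derivative frechet_derivative (in_chart lam c) (at x) v) (at 0)"
    by (rule has_field_derivative_transform_within_open[of _ _ _ "{-a<..<a}"])
      (use a ext in \<open>auto simp: in_chart_def\<close>)
  then show ?thesis using h0 by (rule DERIV_unique)
qed

end

section \<open>Signature\<close>

text \<open>A nondegenerate form that is semidefinite is definite: if it had a null vector \<open>v \<noteq> 0\<close>, the form
  would become negative in the direction opposite to the dual vector \<open>M *v v\<close>.\<close>

lemma nondegenerate_not_definite_imp_negative:
  fixes M :: "real^'n::finite^'n"
  assumes sym: "transpose M = M" and inv: "invertible M"
    and v: "v \<noteq> 0" "v \<bullet> (M *v v) \<le> 0"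
  shows "\<exists>w. w \<bullet> (M *v w) < 0"
proof (rule ccontr)
  assume "\<nexists>w. w \<bullet> (M *v w) < 0"
  then have nonneg: "w \<bullet> (M *v w) \<ge> 0" for w by (meson not_le)
  have v0: "v \<bullet> (M *v v) = 0" using v(2) nonneg[of v] by simp
  define w where "w = M *v v"
  have w: "w \<noteq> 0"
  proof
    assume "w = 0"
    then have "matrix_inv M *v (M *v v) = 0" by (simp only: w_def matrix_vector_mult_0_right)
    then show False using v(1) by (simp add: matrix_vector_mul_assoc matrix_inv_left[OF inv])
  qed
  define b q where "b = w \<bullet> w" and "q = w \<bullet> (M *v w)"
  have b: "b > 0" using w by (simp add: b_def)
  have q: "q \<ge> 0" unfolding q_def by (rule nonneg)
  \<comment> \<open>along \<open>v + s w\<close> the form has derivative \<open>2 b > 0\<close> at \<open>s = 0\<close>, so it is negative for small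
    negative \<open>s\<close>; this \<open>s\<close> is small enough to keep the quadratic term \<open>s\<^sup>2 q\<close> below the linear one\<close>
  define s where "s = - b / (q + 1)"
  have "(v + s *\<^sub>R w) \<bullet> (M *v (v + s *\<^sub>R w)) = s * (2 * b + s * q)"
  proof -
    have "w \<bullet> (M *v v) = b" by (simp add: b_def w_def)
    moreover have "v \<bullet> (M *v w) = b" using form_sym[OF sym, of v w] by (simp add: b_def w_def)
    ultimately show ?thesis
      using v0 by (simp add: q_def[symmetric] matrix_vector_right_distrib matrix_vector_mult_scaleR
          inner_add_left inner_add_right algebra_simps)
  qed
  moreover have "s < 0" using b q by (simp add: s_def divide_neg_pos)
  moreover have "2 * b + s * q > 0"
  proof -
    have "2 * b + s * q = b * (q + 2) / (q + 1)" using q by (simp add: s_def field_simps)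
    then show ?thesis using b q by simp
  qed
  ultimately have "(v + s *\<^sub>R w) \<bullet> (M *v (v + s *\<^sub>R w)) < 0" by (simp add: mult_neg_pos)
  then show False using nonneg[of "v + s *\<^sub>R w"] by simp
qed

lemma form_scale:
  fixes M :: "real^'n::finite^'n"
  shows "(s *\<^sub>R v) \<bullet> (M *v (s *\<^sub>R v)) = s\<^sup>2 * (v \<bullet> (M *v v))"
  by (simp add: matrix_vector_mult_scaleR power2_eq_square)

text \<open>By compactness of the unit sphere a positive definite form is bounded below there, so forms
  nearby are positive definite as well.\<close>

lemma open_positive_definite:
  fixes G :: "real^'n::finite \<Rightarrow> real^'n^'n"
  assumes S: "open S" and G: "continuous_on S G"
  shows "open {x \<in> S. \<forall>v. v \<noteq> 0 \<longrightarrow> v \<bullet> (G x *v v) > 0}"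
  unfolding open_contains_ball
proof
  fix x assume "x \<in> {x \<in> S. \<forall>v. v \<noteq> 0 \<longrightarrow> v \<bullet> (G x *v v) > 0}"
  then have x: "x \<in> S" and pos: "\<And>v. v \<noteq> 0 \<Longrightarrow> v \<bullet> (G x *v v) > 0" by auto
  let ?s = "sphere (0 :: real^'n) 1"
  have "?s \<noteq> {}" by simp
  moreover have "continuous_on ?s (\<lambda>v. v \<bullet> (G x *v v))"
    by (intro continuous_on_inner continuous_on_id linear_continuous_on matrix_vector_mul_bounded_linear)
  ultimately obtain v0 where v0: "v0 \<in> ?s" "\<And>v. v \<in> ?s \<Longrightarrow> v0 \<bullet> (G x *v v0) \<le> v \<bullet> (G x *v v)"
    using continuous_attains_inf[of ?s "\<lambda>v. v \<bullet> (G x *v v)"] compact_sphere by blast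
  define m where "m = v0 \<bullet> (G x *v v0)"
  have m: "m > 0" using v0(1) pos[of v0] unfolding m_def by force
  obtain K where K: "K > 0" "\<And>M v. norm ((M :: real^'n^'n) *v v) \<le> norm M * norm v * K"
    using bounded_bilinear.pos_bounded[OF bounded_bilinear_matrix_vector_mult] by metis
  have "isCont G x" using G S x by (simp add: continuous_on_eq_continuous_at)
  then obtain d where d: "d > 0" "\<And>y. dist y x < d \<Longrightarrow> dist (G y) (G x) < m / K"
    unfolding continuous_at_eps_delta using m K(1) by (metis divide_pos_pos)
  obtain e where e: "e > 0" "ball x e \<subseteq> S" using S x open_contains_ball by blast
  have "v \<bullet> (G y *v v) > 0" if y: "y \<in> ball x (min d e)" and v: "v \<noteq> 0" for y v
  proof -
    define n where "n = v /\<^sub>R norm v"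
    have n: "norm n = 1" using v by (simp add: n_def)
    have "\<bar>n \<bullet> ((G y - G x) *v n)\<bar> \<le> norm n * norm ((G y - G x) *v n)"
      by (rule Cauchy_Schwarz_ineq2)
    also have "\<dots> \<le> norm (G y - G x) * K" using K(2)[of "G y - G x" n] n by simp
    also have "\<dots> < m"
      using d(2)[of y] y K(1) by (simp add: dist_norm norm_minus_commute pos_less_divide_eq)
    finally have "n \<bullet> (G y *v n) > n \<bullet> (G x *v n) - m"
      by (simp add: matrix_vector_mult_diff_rdistrib inner_diff_right)
    then have "n \<bullet> (G y *v n) > 0" using v0(2)[of n] n by (simp add: m_def)
    moreover have "v \<bullet> (G y *v v) = (norm v)\<^sup>2 * (n \<bullet> (G y *v n))"
      using form_scale[of "norm v" n "G y"] v by (simp add: n_def)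
    ultimately show ?thesis using v by simp
  qed
  then show "\<exists>e>0. ball x e \<subseteq> {x \<in> S. \<forall>v. v \<noteq> 0 \<longrightarrow> v \<bullet> (G x *v v) > 0}"
    using d(1) e by (intro exI[of _ "min d e"]) auto
qed

context pseudo_riemannian_manifold
begin

definition positive_definite_at :: "('a, 'n) chart \<Rightarrow> 'a \<Rightarrow> bool" where
  "positive_definite_at c p \<longleftrightarrow> (\<forall>v. v \<noteq> 0 \<longrightarrow> v \<bullet> (g c (coord c p) *v v) > 0)"

lemma positive_definite_at_chart_change:
  assumes c: "c \<in> A" and d: "d \<in> A" and p: "p \<in> dom_chart c" "p \<in> dom_chart d"
    and def: "positive_definite_at c p"
  shows "positive_definite_at d p"
  unfolding positive_definite_at_def
proof (intro allI impI)
  fix v :: "real^'n" assume v: "v \<noteq> 0"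
  let ?D = "frechet_derivative (transition d c) (at (coord d p))"
  note x = coord_in_overlap[OF p(2,1)]
  have "linear ?D"
    using smooth_on_has_derivative[OF smooth_transition[OF d c] x] by (rule has_derivative_linear)
  then have "inj ?D"
    using surj_transition_derivative[OF d c x] by (rule linear_surjective_imp_injective) (rule refl)
  then have "?D v \<noteq> 0" using v \<open>linear ?D\<close> by (metis injD linear_0)
  then have "?D v \<bullet> (g c (coord c p) *v ?D v) > 0" using def unfolding positive_definite_at_def by blast
  then show "v \<bullet> (g d (coord d p) *v v) > 0"
    using metric_pullback[OF d c x] transition_coord[OF d p(2)] by simp
qed

text \<open>The set of points where the metric is positive definite is open by compactness of the sphere.
  Its complement is open as well: by nondegeneracy there is a vector of negative length at every
  point of the complement, and it has negative length nearby. So on a connected manifold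
  definiteness at one point spreads to all points.\<close>

lemma positive_definite_everywhere:
  assumes conn: "connected_space X" and c0: "c0 \<in> A" "p0 \<in> dom_chart c0" "positive_definite_at c0 p0"
  shows "riemannian_metric A g"
proof -
  let ?P = "{p \<in> topspace X. \<exists>c\<in>A. p \<in> dom_chart c \<and> positive_definite_at c p}"
  let ?N = "{p \<in> topspace X. \<exists>c\<in>A. p \<in> dom_chart c \<and> \<not> positive_definite_at c p}"
  have "openin X ?P"
  proof (subst openin_subopen, intro ballI)
    fix p assume "p \<in> ?P"
    then obtain c where c: "c \<in> A" "p \<in> dom_chart c" "positive_definite_at c p" by blast
    let ?U = "{x \<in> img_chart c. \<forall>v. v \<noteq> 0 \<longrightarrow> v \<bullet> (g c x *v v) > 0}"
    have "open ?U"
      by (rule open_positive_definite[OF open_img[OF c(1)]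
            smooth_on_imp_continuous_on[OF metric_smooth[OF c(1)]]])
    then have "openin X {q \<in> dom_chart c. coord c q \<in> ?U}"
      by (rule openin_coord_preimage[OF c(1)])
    moreover have "p \<in> {q \<in> dom_chart c. coord c q \<in> ?U}"
      using c by (simp add: positive_definite_at_def coord_in_img)
    moreover have "{q \<in> dom_chart c. coord c q \<in> ?U} \<subseteq> ?P"
      using c(1) topspace_charts by (auto simp: positive_definite_at_def)
    ultimately show "\<exists>T. openin X T \<and> p \<in> T \<and> T \<subseteq> ?P" by blast
  qed
  moreover have "openin X ?N"
  proof (subst openin_subopen, intro ballI)
    fix p assume "p \<in> ?N"
    then obtain c where c: "c \<in> A" "p \<in> dom_chart c" "\<not> positive_definite_at c p" by blast
    note x = coord_in_img[OF c(2)]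
    obtain v where "v \<noteq> 0" "v \<bullet> (g c (coord c p) *v v) \<le> 0"
      using c(3) unfolding positive_definite_at_def by (auto simp: not_less)
    then obtain w where w: "w \<bullet> (g c (coord c p) *v w) < 0"
      using nondegenerate_not_definite_imp_negative[OF metric_symmetric[OF c(1) x]
          metric_invertible[OF c(1) x]] by blast
    let ?U = "{x \<in> img_chart c. w \<bullet> (g c x *v w) < 0}"
    have "continuous_on (img_chart c) (\<lambda>x. w \<bullet> (g c x *v w))"
      by (intro continuous_on_inner continuous_on_const
          bounded_bilinear.continuous_on[OF bounded_bilinear_matrix_vector_mult]
          smooth_on_imp_continuous_on[OF metric_smooth[OF c(1)]])
    then have "open (img_chart c \<inter> (\<lambda>x. w \<bullet> (g c x *v w)) -` {..<0})"
      by (intro continuous_open_preimage open_img c(1)) auto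
    also have "img_chart c \<inter> (\<lambda>x. w \<bullet> (g c x *v w)) -` {..<0} = ?U" by auto
    finally have "openin X {q \<in> dom_chart c. coord c q \<in> ?U}"
      by (rule openin_coord_preimage[OF c(1)])
    moreover have "p \<in> {q \<in> dom_chart c. coord c q \<in> ?U}" using c(2) x w by simp
    moreover have "{q \<in> dom_chart c. coord c q \<in> ?U} \<subseteq> ?N"
    proof
      fix q assume q: "q \<in> {q \<in> dom_chart c. coord c q \<in> ?U}"
      then have "w \<noteq> 0" "\<not> w \<bullet> (g c (coord c q) *v w) > 0" by auto
      then have "\<not> positive_definite_at c q" unfolding positive_definite_at_def by blast
      then show "q \<in> ?N" using q c(1) topspace_charts by auto
    qed
    ultimately show "\<exists>T. openin X T \<and> p \<in> T \<and> T \<subseteq> ?N" by blast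
  qed
  moreover have "topspace X - ?P = ?N"
    using positive_definite_at_chart_change topspace_charts by fast
  ultimately have "closedin X ?P" "openin X ?P" by (auto simp: closedin_def)
  moreover have "p0 \<in> ?P" using c0 topspace_charts by blast
  ultimately have P: "?P = topspace X" using conn unfolding connected_space_clopen_in by blast
  have "v \<bullet> (g c x *v v) > 0" if "c \<in> A" "x \<in> img_chart c" "v \<noteq> 0" for c x v
  proof -
    let ?p = "inv_chart c x"
    have p: "?p \<in> dom_chart c" by (rule inv_chart_in_dom[OF that(2)])
    then have "?p \<in> ?P" using that(1) topspace_charts P by blast
    then have "positive_definite_at c ?p" using positive_definite_at_chart_change p that(1) by blast
    then show ?thesis using that(3) coord_inv_chart[OF that(2)] by (simp add: positive_definite_at_def)
  qed
  then show ?thesis using metric unfolding riemannian_metric_def by blast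
qed

end

lemma pseudo_riemannian_metric_uminus:
  fixes A :: "('a, 'n::finite) chart set" and g :: "('a, 'n) tensor2"
  assumes "smooth_manifold X A" "pseudo_riemannian_metric A g"
  shows "pseudo_riemannian_metric A (\<lambda>c x. - g c x)"
proof -
  interpret pseudo_riemannian_manifold X A g using assms by unfold_locales
  have neg: "(- M) ** (- B) = M ** B" for M B :: "real^'n^'n"
    by (simp add: vec_eq_iff matrix_matrix_mult_def)
  have "smooth_on (img_chart c) (\<lambda>x. - g c x)" if "c \<in> A" for c
    using metric_smooth[OF that] C_k_on_minus[OF open_img[OF that]] unfolding smooth_on_def by blast
  moreover have "- (transpose J ** M ** J) = transpose J ** (- M) ** J" for M J :: "real^'n^'n"
    by (simp add: vec_eq_iff matrix_matrix_mult_def sum_negf)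
  moreover have "transpose (- g c x) = - g c x" "invertible (- g c x)" if "c \<in> A" "x \<in> img_chart c" for c x
  proof -
    show "transpose (- g c x) = - g c x"
      using metric_symmetric[OF that] by (simp add: vec_eq_iff transpose_def)
    show "invertible (- g c x)"
      using metric_invertible[OF that] unfolding invertible_def by (metis neg)
  qed
  ultimately show ?thesis
    using metric unfolding pseudo_riemannian_metric_def smooth_tensor2_def Let_def by simp
qed

text \<open>Were the metric positive definite at one point, it would be Riemannian; were it negative definite
  there, its negative would be.\<close>

lemma (in pseudo_riemannian_manifold) indefinite_at_every_point:
  assumes conn: "connected_space X" and indef: "indefinite_signature A g"
    and c: "c \<in> A" and x: "x \<in> img_chart c"
  obtains v w where "v \<bullet> (g c x *v v) > 0" "w \<bullet> (g c x *v w) < 0"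
proof -
  let ?p = "inv_chart c x"
  note p = inv_chart_in_dom[OF x] coord_inv_chart[OF x]
  have not_riemannian: "\<not> riemannian_metric A (\<lambda>c x. k *\<^sub>R g c x)" for k
    using indef unfolding indefinite_signature_def by blast
  have "\<not> positive_definite_at c ?p"
    using positive_definite_everywhere[OF conn c p(1)] not_riemannian[of 1] by auto
  then obtain w where "w \<noteq> 0" "w \<bullet> (g c x *v w) \<le> 0"
    unfolding positive_definite_at_def p(2) by (auto simp: not_less)
  then obtain w' where w': "w' \<bullet> (g c x *v w') < 0"
    using nondegenerate_not_definite_imp_negative[OF metric_symmetric[OF c x] metric_invertible[OF c x]]
    by blast
  interpret neg: pseudo_riemannian_manifold X A "\<lambda>c x. - g c x"
    using manifold metric pseudo_riemannian_metric_uminus by unfold_locales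
  have "\<not> neg.positive_definite_at c ?p"
    using neg.positive_definite_everywhere[OF conn c p(1)] not_riemannian[of "- 1"] by auto
  then obtain v where "v \<noteq> 0" "v \<bullet> (- g c x *v v) \<le> 0"
    unfolding neg.positive_definite_at_def p(2) by (auto simp: not_less)
  then obtain v' where "v' \<bullet> (- g c x *v v') < 0"
    using nondegenerate_not_definite_imp_negative[OF neg.metric_symmetric[OF c x]
        neg.metric_invertible[OF c x]] by blast
  then have "v' \<bullet> (g c x *v v') > 0"
    by (simp add: inner_vec_def matrix_vector_mult_def sum_negf)
  then show thesis using w' by (rule that)
qed

section \<open>Constancy\<close>

theorem (in pseudo_riemannian_manifold) constant_if_derivative_zero:
  assumes conn: "connected_space X" and lam: "smooth_function A lam"
    and zero: "\<And>c x v. c \<in> A \<Longrightarrow> x \<in> img_chart c \<Longrightarrow> frechet_derivative (in_chart lam c) (at x) v = 0"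
    and p0: "p0 \<in> topspace X" and p: "p \<in> topspace X"
  shows "lam p = lam p0"
proof -
  let ?E = "{p \<in> topspace X. lam p \<in> {lam p0}}"
  have "closedin X ?E"
    by (rule closedin_continuous_map_preimage[OF continuous_smooth_function[OF lam]]) simp
  moreover have "openin X ?E"
  proof (subst openin_subopen, intro ballI)
    fix p assume p: "p \<in> ?E"
    then obtain c where c: "c \<in> A" "p \<in> dom_chart c" using topspace_charts by blast
    obtain e where e: "e > 0" "ball (coord c p) e \<subseteq> img_chart c"
      using open_img[OF c(1)] coord_in_img[OF c(2)] open_contains_ball by blast
    have L: "smooth_on (img_chart c) (in_chart lam c)"
      using lam c(1) unfolding smooth_function_def by blast
    have "\<exists>k. \<forall>x\<in>ball (coord c p) e. in_chart lam c x = k"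
    proof (rule has_derivative_zero_constant[OF convex_ball])
      fix x assume "x \<in> ball (coord c p) e"
      then have x: "x \<in> img_chart c" using e by blast
      have "frechet_derivative (in_chart lam c) (at x) = (\<lambda>v. 0)" using zero[OF c(1) x] by blast
      then show "(in_chart lam c has_derivative (\<lambda>v. 0)) (at x within ball (coord c p) e)"
        using smooth_on_has_derivative[OF L x] has_derivative_at_withinI by metis
    qed
    then obtain k where k: "\<And>x. x \<in> ball (coord c p) e \<Longrightarrow> in_chart lam c x = k" by blast
    let ?U = "{q \<in> dom_chart c. coord c q \<in> ball (coord c p) e}"
    have U: "lam q = k" if "q \<in> ?U" for q
      using k[of "coord c q"] that by (simp add: in_chart_def inv_chart_coord[OF c(1)])
    have "p \<in> ?U" using c(2) e(1) by simp
    moreover have "?U \<subseteq> ?E"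
      using U[OF \<open>p \<in> ?U\<close>] U p c(1) topspace_charts by auto
    moreover have "openin X ?U" by (rule openin_coord_preimage[OF c(1)]) simp
    ultimately show "\<exists>T. openin X T \<and> p \<in> T \<and> T \<subseteq> ?E" by blast
  qed
  moreover have "p0 \<in> ?E" using p0 by simp
  ultimately have "?E = topspace X" using conn unfolding connected_space_clopen_in by blast
  then show ?thesis using p by blast
qed

theorem theorem1:
  fixes X :: "'a topology" and A :: "('a, 'n::finite) chart set"
    and g :: "('a, 'n) tensor2" and lam :: "'a \<Rightarrow> real"
  assumes "closed_manifold X A" and "connected_space X"
    and "pseudo_riemannian_metric A g" and "indefinite_signature A g"
    and "light_line_complete X A g"
    and "smooth_function A lam" and "tanno_equation A g lam"
  shows "\<exists>k. \<forall>p\<in>topspace X. lam p = k"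
proof -
  have compact: "compact_space X" and manifold: "smooth_manifold X A"
    using assms(1) unfolding closed_manifold_def by auto
  interpret pseudo_riemannian_manifold X A g
    using manifold assms(3) by unfold_locales
  have "frechet_derivative (in_chart lam c) (at x) z = 0" if c: "c \<in> A" and x: "x \<in> img_chart c" for c x z
  proof -
    have "(in_chart lam c has_derivative frechet_derivative (in_chart lam c) (at x)) (at x)"
      using assms(6) c x smooth_on_has_derivative unfolding smooth_function_def by blast
    then have "linear (frechet_derivative (in_chart lam c) (at x))" by (rule has_derivative_linear)
    moreover obtain v w where "v \<bullet> (g c x *v v) > 0" "w \<bullet> (g c x *v w) < 0"
      using indefinite_at_every_point[OF assms(2,4) c x] by blast
    ultimately show ?thesis
      using functional_zero_on_null_vectors[OF metric_symmetric[OF c x]]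
        tanno_derivative_zero_on_null_vectors[OF assms(5) compact assms(6,7) c x] by blast
  qed
  then show ?thesis
    using constant_if_derivative_zero[OF assms(2,6)] by blast
qed

end
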